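(* Let $(\lambda,\mu)\in{\sf Kostka}_r^{\mathbb Z}$. The underlying undirected graph of the KGR graph $G(\lambda,\mu)$ is a forest, and it is planar with respect to the embedding in which each vertex is placed at its matrix position and each arc is drawn as a straight segment (no two arcs cross). Consequently any conservative subtree of $G(\lambda,\mu)$ is a tree. Moreover, if $G(\lambda,\mu)$ has a conservative subtree, then $(\lambda,\mu)$ is not in the Hilbert basis of ${\sf Kostka}_r^{\mathbb Z}$.
   Context: Fix $r\ge1$. ${\sf Kostka}_r^{\mathbb Z}$ is the semigroup (componentwise addition) of pairs $(\lambda,\mu)$ of partitions with at most $r$ nonzero parts, $|\lambda|=|\mu|$, $\sum_{i\le t}\lambda_i\ge\sum_{i\le t}\mu_i$ for all $t$; its Hilbert basis is the set of nonzero elements not expressible as a sum of two nonzero elements. $\lambda'$ is the conjugate partition. Canonical (Ryser) matrix $A(\lambda,\mu)$: let $s=\lambda_1$. Start with the $r\times s$ $\{0,1\}$-matrix whose row $i$ has $\mu_i$ ones in columns $1,\ldots,\mu_i$. For $j=s,s-1,\ldots,1$ in turn: looking only at columns $1,\ldots,j$ of the current matrix, choose $\lambda'_j$ rows, taking rows with the largest number of $1$'s in columns $1,\ldots,j$ and breaking ties by preferring rows further south (larger row index); in each chosen row, move the rightmost $1$ among columns $1,\ldots,j$ to column $j$. Columns $j,\ldots,s$ are not changed afterwards. The final matrix is $A(\lambda,\mu)$ (row sums $\mu_i$, column sums $\lambda'_j$). Define $A^*(\lambda,\mu)_{i,j}=A(\lambda,\mu)_{i,j}-A(\lambda,\mu)_{i+1,j}$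 (with row $r+1$ taken to be $0$); its entries lie in $\{-1,0,1\}$. KGR graph $G(\lambda,\mu)$: a directed graph whose vertices are the positions of the nonzero entries of $A^*(\lambda,\mu)$, with arcs: (I) (horizontal) from each $-1$ entry to the rightmost $1$ entry strictly to its left in the same row; (II) (vertical) from each $1$ entry to the $-1$ entry in the same column, if one exists. A source of a directed graph is a vertex with no incoming arcs, a sink a vertex with no outgoing arcs; connectivity refers to the underlying undirected graph. A \emph{conservative subtree} of $G(\lambda,\mu)$ is a connected nontrivial subgraph $G'$ such that whenever a vertical arc appears in $G'$, all vertical arcs of $G(\lambda,\mu)$ in the same column appear in $G'$, and one of the following holds: (C.1) $G'$ is a connected component of $G(\lambda,\mu)$; (C.2) $G'$ has a unique sink, it is a $-1$ entry of $A^*(\lambda,\mu)$, one source of $G'$ is a $1$ entry in the same row as this sink, and all other sources of $G'$ are sources of $G(\lambda,\mu)$. *)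

theory Defs
  imports
    "HOL-Analysis.Analysis"
    "HOL-Library.Function_Algebras"
    "HOL-Library.Product_Plus"
    "Graph_Theory.Digraph_Component"
begin

text \<open>
  Parts, rows and columns are indexed from 0: the part usually written \<open>\<lambda>\<^sub>i\<close> is \<open>l (i - 1)\<close>, and
  entry \<open>(i, j)\<close> of a matrix is \<open>M (i - 1) (j - 1)\<close>.
\<close>

section \<open>The Kostka semigroup\<close>

definition partition_le :: "nat \<Rightarrow> (nat \<Rightarrow> nat) \<Rightarrow> bool" where
  "partition_le r l \<longleftrightarrow> antimono l \<and> (\<forall>i\<ge>r. l i = 0)"

definition conjugate :: "(nat \<Rightarrow> nat) \<Rightarrow> nat \<Rightarrow> nat" where
  "conjugate l j = card {i. j < l i}"

definition Kostka :: "nat \<Rightarrow> ((nat \<Rightarrow> nat) \<times> (nat \<Rightarrow> nat)) set" where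
  "Kostka r = {(l, m). partition_le r l \<and> partition_le r m \<and>
     (\<Sum>i<r. l i) = (\<Sum>i<r. m i) \<and> (\<forall>t. (\<Sum>i<t. m i) \<le> (\<Sum>i<t. l i))}"

definition hilbert_basis :: "'a::monoid_add set \<Rightarrow> 'a set" where
  "hilbert_basis S = {x \<in> S. x \<noteq> 0 \<and> \<not> (\<exists>y\<in>S. \<exists>z\<in>S. y \<noteq> 0 \<and> z \<noteq> 0 \<and> x = y + z)}"

section \<open>The canonical matrix\<close>

definition ones_upto :: "(nat \<Rightarrow> nat \<Rightarrow> int) \<Rightarrow> nat \<Rightarrow> nat \<Rightarrow> nat" where
  "ones_upto M j i = card {c. c \<le> j \<and> M i c = 1}"

definition preferred :: "(nat \<Rightarrow> nat \<Rightarrow> int) \<Rightarrow> nat \<Rightarrow> nat \<Rightarrow> nat \<Rightarrow> bool" where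
  "preferred M j i i' \<longleftrightarrow>
     ones_upto M j i > ones_upto M j i' \<or> (ones_upto M j i = ones_upto M j i' \<and> i > i')"

text \<open>The first \<open>k\<close> of the rows \<open>0, \<dots>, r - 1\<close> in the strict linear order \<^const>\<open>preferred\<close>.\<close>

definition chosen_rows :: "nat \<Rightarrow> nat \<Rightarrow> (nat \<Rightarrow> nat \<Rightarrow> int) \<Rightarrow> nat \<Rightarrow> nat set" where
  "chosen_rows r k M j = {i. i < r \<and> card {i'. i' < r \<and> preferred M j i' i} < k}"

text \<open>
  A row without a 1 in columns \<open>0, \<dots>, j\<close> is left alone; for pairs in \<^const>\<open>Kostka\<close> no such row
  is ever chosen.
\<close>

definition move_one :: "nat \<Rightarrow> (nat \<Rightarrow> int) \<Rightarrow> nat \<Rightarrow> int" where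
  "move_one j R =
     (if \<exists>c\<le>j. R c = 1 then (R(Max {c. c \<le> j \<and> R c = 1} := 0))(j := 1) else R)"

definition ryser_step ::
    "nat \<Rightarrow> (nat \<Rightarrow> nat) \<Rightarrow> nat \<Rightarrow> (nat \<Rightarrow> nat \<Rightarrow> int) \<Rightarrow> nat \<Rightarrow> nat \<Rightarrow> int" where
  "ryser_step r l j M =
     (\<lambda>i. if i \<in> chosen_rows r (conjugate l j) M j then move_one j (M i) else M i)"

definition initial_matrix :: "nat \<Rightarrow> (nat \<Rightarrow> nat) \<Rightarrow> nat \<Rightarrow> nat \<Rightarrow> int" where
  "initial_matrix r m i j = (if i < r \<and> j < m i then 1 else 0)"

definition canonical_matrix :: "nat \<Rightarrow> (nat \<Rightarrow> nat) \<Rightarrow> (nat \<Rightarrow> nat) \<Rightarrow> nat \<Rightarrow> nat \<Rightarrow> int" where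
  "canonical_matrix r l m = fold (ryser_step r l) (rev [0..<l 0]) (initial_matrix r m)"

text \<open>Row \<open>r\<close> of the canonical matrix is zero, so the last row needs no separate case.\<close>

definition star_matrix :: "nat \<Rightarrow> (nat \<Rightarrow> nat) \<Rightarrow> (nat \<Rightarrow> nat) \<Rightarrow> nat \<Rightarrow> nat \<Rightarrow> int" where
  "star_matrix r l m i j = canonical_matrix r l m i j - canonical_matrix r l m (Suc i) j"

section \<open>The KGR graph\<close>

definition kgr_verts :: "nat \<Rightarrow> (nat \<Rightarrow> nat) \<Rightarrow> (nat \<Rightarrow> nat) \<Rightarrow> (nat \<times> nat) set" where
  "kgr_verts r l m = {(i, j). i < r \<and> j < l 0 \<and> star_matrix r l m i j \<noteq> 0}"

definition kgr_horizontal :: "nat \<Rightarrow> (nat \<Rightarrow> nat) \<Rightarrow> (nat \<Rightarrow> nat) \<Rightarrow> (nat \<times> nat) rel" where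
  "kgr_horizontal r l m =
     {((i, j), (i, k)) | i j k.
        (i, j) \<in> kgr_verts r l m \<and> (i, k) \<in> kgr_verts r l m \<and>
        star_matrix r l m i j = -1 \<and> star_matrix r l m i k = 1 \<and> k < j \<and>
        (\<forall>c. k < c \<and> c < j \<longrightarrow> star_matrix r l m i c \<noteq> 1)}"

definition kgr_vertical :: "nat \<Rightarrow> (nat \<Rightarrow> nat) \<Rightarrow> (nat \<Rightarrow> nat) \<Rightarrow> (nat \<times> nat) rel" where
  "kgr_vertical r l m =
     {((i, j), (k, j)) | i j k.
        (i, j) \<in> kgr_verts r l m \<and> (k, j) \<in> kgr_verts r l m \<and>
        star_matrix r l m i j = 1 \<and> star_matrix r l m k j = -1}"

definition kgr_graph :: "nat \<Rightarrow> (nat \<Rightarrow> nat) \<Rightarrow> (nat \<Rightarrow> nat) \<Rightarrow> (nat \<times> nat) pair_pre_digraph" where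
  "kgr_graph r l m =
     \<lparr> pverts = kgr_verts r l m, parcs = kgr_horizontal r l m \<union> kgr_vertical r l m \<rparr>"

section \<open>Graph notions\<close>

definition graph_sources :: "'a pair_pre_digraph \<Rightarrow> 'a set" where
  "graph_sources G = {v \<in> pverts G. in_arcs (with_proj G) v = {}}"

definition graph_sinks :: "'a pair_pre_digraph \<Rightarrow> 'a set" where
  "graph_sinks G = {v \<in> pverts G. out_arcs (with_proj G) v = {}}"

text \<open>
  The library's \<^const>\<open>Digraph_Component.forest\<close> and \<^const>\<open>Digraph_Component.tree\<close> only forbid
  directed cycles. Here cycles of the underlying undirected graph are forbidden. In its symmetric
  digraph, the closed walks that are a \<open>cycle\<close> of length 2 just run along one edge
  and back, so they do not count.
\<close>

definition undirected_forest :: "'a pair_pre_digraph \<Rightarrow> bool" where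
  "undirected_forest G \<longleftrightarrow>
     \<not> (\<exists>p. pre_digraph.cycle (with_proj (mk_symmetric (with_proj G))) p \<and> length p \<noteq> 2)"

definition undirected_tree :: "'a pair_pre_digraph \<Rightarrow> bool" where
  "undirected_tree G \<longleftrightarrow> Digraph_Component.connected (with_proj G) \<and> undirected_forest G"

definition connected_component_of :: "'a pair_pre_digraph \<Rightarrow> 'a pair_pre_digraph \<Rightarrow> bool" where
  "connected_component_of H G \<longleftrightarrow>
     pre_digraph.max_subgraph (with_proj G) Digraph_Component.connected (with_proj H)"

definition straight_line_plane :: "('a \<Rightarrow> real \<times> real) \<Rightarrow> 'a pair_pre_digraph \<Rightarrow> bool" where
  "straight_line_plane pos G \<longleftrightarrow>
     inj_on pos (pverts G) \<and>
     (\<forall>(u, v)\<in>parcs G. \<forall>w\<in>pverts G.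
        pos w \<in> closed_segment (pos u) (pos v) \<longrightarrow> w \<in> {u, v}) \<and>
     (\<forall>(u, v)\<in>parcs G. \<forall>(x, y)\<in>parcs G. (u, v) \<noteq> (x, y) \<longrightarrow>
        closed_segment (pos u) (pos v) \<inter> closed_segment (pos x) (pos y)
          \<subseteq> pos ` ({u, v} \<inter> {x, y}))"

text \<open>Columns run to the right and rows run downwards.\<close>

definition matrix_position :: "nat \<times> nat \<Rightarrow> real \<times> real" where
  "matrix_position = (\<lambda>(i, j). (real j, - real i))"

section \<open>Conservative subtrees\<close>

text \<open>
  A subgraph is nontrivial if it is neither empty nor the whole graph; a single vertex is allowed.
  The whole graph has to be excluded: for \<open>r = 2\<close>, \<open>\<lambda> = (2)\<close> and \<open>\<mu> = (1, 1)\<close> the KGR graph is a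
  path on three vertices, hence a component of itself, but the pair is in the Hilbert basis.
\<close>

definition conservative_subtree ::
    "nat \<Rightarrow> (nat \<Rightarrow> nat) \<Rightarrow> (nat \<Rightarrow> nat) \<Rightarrow> (nat \<times> nat) pair_pre_digraph \<Rightarrow> bool" where
  "conservative_subtree r l m H \<longleftrightarrow>
     subgraph (with_proj H) (with_proj (kgr_graph r l m)) \<and>
     Digraph_Component.connected (with_proj H) \<and>
     pverts H \<noteq> {} \<and> H \<noteq> kgr_graph r l m \<and>
     (\<forall>i j k i' k'. ((i, j), (k, j)) \<in> parcs H \<inter> kgr_vertical r l m \<and>
        ((i', j), (k', j)) \<in> kgr_vertical r l m \<longrightarrow> ((i', j), (k', j)) \<in> parcs H) \<and>
     (connected_component_of H (kgr_graph r l m) \<or>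
      (\<exists>i j k. graph_sinks H = {(i, j)} \<and> star_matrix r l m i j = -1 \<and>
         (i, k) \<in> graph_sources H \<and> star_matrix r l m i k = 1 \<and>
         graph_sources H - {(i, k)} \<subseteq> graph_sources (kgr_graph r l m)))"

end

theory Submission
  imports Defs
begin

text \<open>
  Before column \<open>j\<close> is processed, the rows are left-justified in the columns up to \<open>j\<close> and their
  lengths form a partition. A -1 of the star matrix in row \<open>i\<close> and column \<open>j\<close> means that rows \<open>i\<close>
  and \<open>i + 1\<close> were tied and the tie was broken to the south. Hence a column has at most one -1,
  and in every row each -1 is directly preceded by its own 1. So every vertex of the KGR graph
  has at most one outgoing arc, and along arcs the column never increases: the graph is a forest.
  It is plane since the rows crossed by a vertical arc are tied, whereas along a horizontal arc
  in row \<open>i\<close> the rows \<open>i\<close> and \<open>i + 1\<close> are not.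

  The columns met by a conservative subtree split the canonical matrix into two matrices. The row
  sums of either part decrease weakly as long as each of its -1s can be matched with a 1 of
  the part in the same row; then the parts belong to the Kostka semigroup and add up to the pair.
\<close>

section \<open>Conjugate partitions and dominance\<close>

lemma less_conjugate_iff:
  assumes "partition_le r l"
  shows "i < conjugate l c \<longleftrightarrow> c < l i"
proof -
  define n where "n = (LEAST i. l i \<le> c)"
  have anti: "l s \<le> l u" if "u \<le> s" for u s
    using assms that by (simp add: partition_le_def antimonoD)
  have "l r \<le> c"
    using assms by (simp add: partition_le_def)
  then have "l n \<le> c"
    unfolding n_def by (rule LeastI)
  then have "{i. c < l i} = {..<n}"
    using anti[of n] by (force simp: n_def not_le[symmetric] dest: not_less_Least)
  then show ?thesis
    by (simp add: conjugate_def set_eq_iff)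
qed

lemma conjugate_le:
  assumes "partition_le r l"
  shows "conjugate l c \<le> r"
  using less_conjugate_iff[OF assms, of r c] assms by (auto simp: partition_le_def)

lemma antimono_conjugate:
  assumes "partition_le r l"
  shows "antimono (conjugate l)"
  by (rule antimonoI) (metis assms le_less_trans less_conjugate_iff less_irrefl not_le)

lemma card_less_Int_lessThan: "card {x \<in> {..<y}. x < a} = min y a" for y a :: nat
proof -
  have "{x \<in> {..<y}. x < a} = {..<min y a}"
    by auto
  then show ?thesis
    by simp
qed

lemma sum_conjugate:
  assumes "partition_le r l"
  shows "(\<Sum>c<y. conjugate l c) = (\<Sum>i<r. min y (l i))"
proof -
  have "card {i \<in> {..<r}. c < l i} = conjugate l c" for c
  proof -
    have "i < r" if "c < l i" for i
      using assms that by (auto simp: partition_le_def intro: ccontr)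
    then show ?thesis
      unfolding conjugate_def by (intro arg_cong[of _ _ card]) auto
  qed
  then have "(\<Sum>i<r. card {c \<in> {..<y}. c < l i}) = (\<Sum>c<y. conjugate l c)"
    by (intro sum_multicount_gen) auto
  then show ?thesis
    by (simp only: card_less_Int_lessThan)
qed

text \<open>
  Cut at the row \<open>n\<close> where \<open>m\<close> drops to \<open>y\<close> or below: all summands on the right before it are \<open>y\<close>.
\<close>

lemma sum_min_le_of_dominated:
  assumes partition: "partition_le r m"
    and total: "(\<Sum>i<r. l i) = (\<Sum>i<r. m i)"
    and dominated: "\<And>t. (\<Sum>i<t. m i) \<le> (\<Sum>i<t. l i)"
  shows "(\<Sum>i<r. min y (l i)) \<le> (\<Sum>i<r. min y (m i))"
proof -
  define n where "n = conjugate m y"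
  have "n \<le> r"
    unfolding n_def by (rule conjugate_le[OF partition])
  then have split: "(\<Sum>i<r. f i) = (\<Sum>i<n. f i) + (\<Sum>i=n..<r. f i)" for f :: "nat \<Rightarrow> nat"
    by (simp add: lessThan_atLeast0 sum.atLeastLessThan_concat)
  have "(\<Sum>i<r. min y (l i)) \<le> (\<Sum>i<n. y) + (\<Sum>i=n..<r. l i)"
    unfolding split by (intro add_mono sum_mono) auto
  also have "(\<Sum>i=n..<r. l i) \<le> (\<Sum>i=n..<r. m i)"
    using dominated[of n] total unfolding split by linarith
  also have "(\<Sum>i<n. y) + (\<Sum>i=n..<r. m i) = (\<Sum>i<r. min y (m i))"
    using less_conjugate_iff[OF partition, of _ y] unfolding split n_def
    by (intro arg_cong2[of _ _ _ _ "(+)"] sum.cong) (auto simp: not_less[symmetric])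
  finally show ?thesis
    by simp
qed

section \<open>Correctness of Ryser's construction\<close>

text \<open>
  The conditions of Gale and Ryser for a 0-1 matrix with column sums \<open>p\<close> and row sums \<open>k\<close>.
  Comparing sums of columns rather than rows makes them easy to maintain when the last column
  is removed.
\<close>

definition gale_ryser :: "nat \<Rightarrow> (nat \<Rightarrow> nat) \<Rightarrow> nat \<Rightarrow> (nat \<Rightarrow> nat) \<Rightarrow> bool" where
  "gale_ryser r p j k \<longleftrightarrow> partition_le r k \<and> (\<forall>i. k i \<le> j) \<and> (\<Sum>i<r. k i) = (\<Sum>c<j. p c) \<and>
     (\<forall>y\<le>j. (\<Sum>c<y. p c) \<le> (\<Sum>i<r. min y (k i)))"

definition greedy_rows :: "nat \<Rightarrow> (nat \<Rightarrow> 'a::linorder) \<Rightarrow> nat set \<Rightarrow> bool" where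
  "greedy_rows r k C \<longleftrightarrow> C \<subseteq> {..<r} \<and>
     (\<forall>s\<in>C. \<forall>u<r. k s < k u \<or> k s = k u \<and> s < u \<longrightarrow> u \<in> C)"

lemma greedy_rows_subset: "greedy_rows r k C \<Longrightarrow> C \<subseteq> {..<r}"
  by (simp add: greedy_rows_def)

lemma greedy_rows_longer: "greedy_rows r k C \<Longrightarrow> s \<in> C \<Longrightarrow> u < r \<Longrightarrow> k s < k u \<Longrightarrow> u \<in> C"
  unfolding greedy_rows_def by blast

lemma greedy_rows_southern:
  "greedy_rows r k C \<Longrightarrow> s \<in> C \<Longrightarrow> s \<le> u \<Longrightarrow> u < r \<Longrightarrow> k s = k u \<Longrightarrow> u \<in> C"
  unfolding greedy_rows_def le_less by blast

lemma greedy_rows_tied: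
  assumes greedy: "greedy_rows r k C" and anti: "antimono k"
    and "s \<in> C" "u \<notin> C" "u \<le> i" "i \<le> s"
  shows "k i = k s"
proof (rule antisym)
  have "s < r"
    using greedy_rows_subset[OF greedy] \<open>s \<in> C\<close> by auto
  then have "u < r"
    using assms(5,6) by simp
  then have "k u \<le> k s"
    using greedy_rows_longer[OF greedy] assms by force
  then show "k i \<le> k s"
    using antimonoD[OF anti \<open>u \<le> i\<close>] by simp
  show "k s \<le> k i"
    using antimonoD[OF anti \<open>i \<le> s\<close>] .
qed

definition shorten :: "nat set \<Rightarrow> (nat \<Rightarrow> nat) \<Rightarrow> nat \<Rightarrow> nat" where
  "shorten C k i = k i - of_bool (i \<in> C)"

lemma antimono_shorten:
  assumes greedy: "greedy_rows r k C" and anti: "antimono k" and zero: "\<And>i. r \<le> i \<Longrightarrow> k i = 0"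
  shows "antimono (shorten C k)"
proof (rule antimonoI)
  fix u s :: nat assume "u \<le> s"
  show "shorten C k s \<le> shorten C k u"
  proof (cases "u \<in> C \<and> s \<notin> C \<and> s < r")
    case True
    then have "k s \<noteq> k u"
      using greedy_rows_southern[OF greedy, of u s] \<open>u \<le> s\<close> by auto
    then show ?thesis
      using antimonoD[OF anti \<open>u \<le> s\<close>] True by (simp add: shorten_def)
  next
    case False
    then show ?thesis
      using antimonoD[OF anti \<open>u \<le> s\<close>] zero[of s] by (auto simp: shorten_def of_bool_def)
  qed
qed

lemma sum_of_bool_greedy_rows:
  assumes "greedy_rows r k C"
  shows "(\<Sum>i<r. of_bool (i \<in> C)) = card C"
  using greedy_rows_subset[OF assms] by (simp add: Int_absorb1)

text \<open>All rows longer than \<open>y\<close> are shortened, so column \<open>y\<close> makes up for the missing cells.\<close>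

lemma sum_min_shorten:
  assumes greedy: "greedy_rows r k C" and nonempty: "\<And>i. i \<in> C \<Longrightarrow> 0 < k i"
    and short: "s \<in> C" "k s \<le> y"
  shows "(\<Sum>i<r. min y (shorten C k i)) + card C = (\<Sum>i<r. min (Suc y) (k i))"
  unfolding sum_of_bool_greedy_rows[OF greedy, symmetric] sum.distrib[symmetric]
proof (rule sum.cong)
  fix i assume "i \<in> {..<r}"
  then have "i \<in> C" if "y < k i"
    using greedy_rows_longer[OF greedy short(1), of i] short(2) that by simp
  then show "min y (shorten C k i) + of_bool (i \<in> C) = min (Suc y) (k i)"
    using nonempty[of i] by (cases "y < k i") (auto simp: shorten_def)
qed simp

lemma column_sums_le_shorten:
  assumes greedy: "greedy_rows r k C" and nonempty: "\<And>i. i \<in> C \<Longrightarrow> 0 < k i"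
    and height: "card C \<le> p y"
    and columns: "(\<Sum>c<y. p c) \<le> (\<Sum>i<r. min y (k i))"
      "(\<Sum>c<Suc y. p c) \<le> (\<Sum>i<r. min (Suc y) (k i))"
  shows "(\<Sum>c<y. p c) \<le> (\<Sum>i<r. min y (shorten C k i))"
proof (cases "\<exists>s\<in>C. k s \<le> y")
  case True
  then obtain s where short: "s \<in> C" "k s \<le> y"
    by blast
  have "(\<Sum>c<y. p c) + card C \<le> (\<Sum>c<Suc y. p c)"
    using height by simp
  also have "\<dots> \<le> (\<Sum>i<r. min (Suc y) (k i))"
    by (rule columns(2))
  also have "\<dots> = (\<Sum>i<r. min y (shorten C k i)) + card C"
    using sum_min_shorten[OF greedy nonempty short] by simp
  finally show ?thesis
    by simp
next
  case False
  then have "min y (k i) = min y (shorten C k i)" for i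
    by (auto simp: shorten_def of_bool_def)
  then show ?thesis
    using columns(1) by simp
qed

lemma greedy_rows_nonempty:
  assumes fits: "gale_ryser r p (Suc j) k" and heights: "antimono p"
    and greedy: "greedy_rows r k C" and card_C: "card C = p j" and "i \<in> C"
  shows "0 < k i"
proof (rule ccontr)
  assume "\<not> 0 < k i"
  let ?P = "{u. u < r \<and> 0 < k u}"
  have "p j \<le> p 0"
    using heights by (simp add: antimonoD)
  also have "p 0 \<le> (\<Sum>u<r. min 1 (k u))"
    using fits by (auto simp: gale_ryser_def dest!: spec[of _ 1])
  also have "\<dots> = (\<Sum>u<r. of_bool (0 < k u))"
    by (rule sum.cong) auto
  also have "\<dots> = card ?P"
    by (simp add: lessThan_def Collect_conj_eq)
  also have "\<dots> < card C"
  proof (rule psubset_card_mono)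
    show "?P \<subset> C"
      using greedy_rows_longer[OF greedy \<open>i \<in> C\<close>] \<open>i \<in> C\<close> \<open>\<not> 0 < k i\<close> by auto
    show "finite C"
      using greedy_rows_subset[OF greedy] finite_subset by blast
  qed
  finally show False
    using card_C by simp
qed

lemma greedy_rows_full:
  assumes fits: "gale_ryser r p (Suc j) k"
    and greedy: "greedy_rows r k C" and card_C: "card C = p j" and full: "k i = Suc j"
  shows "i \<in> C"
proof (rule ccontr)
  assume "i \<notin> C"
  let ?F = "{u. u < r \<and> k u = Suc j}"
  have bounded: "k u \<le> Suc j" for u
    using fits by (simp add: gale_ryser_def)
  have "i < r"
    using fits full by (auto simp: gale_ryser_def partition_le_def intro: ccontr)
  have "k s = Suc j" if "s \<in> C" for s
  proof -
    have "\<not> k s < k i"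
      using greedy_rows_longer[OF greedy that \<open>i < r\<close>] \<open>i \<notin> C\<close> by blast
    then show ?thesis
      using bounded[of s] full by simp
  qed
  then have "C \<subset> ?F"
    using greedy_rows_subset[OF greedy] \<open>i < r\<close> full \<open>i \<notin> C\<close> by auto
  then have "p j < card ?F"
    unfolding card_C[symmetric] by (rule psubset_card_mono[rotated]) simp
  also have "card ?F = (\<Sum>u<r. of_bool (k u = Suc j))"
    by (simp add: lessThan_def Collect_conj_eq)
  finally have "(\<Sum>c<Suc j. p c) < (\<Sum>c<j. p c) + (\<Sum>u<r. of_bool (k u = Suc j))"
    by simp
  also have "(\<Sum>c<j. p c) \<le> (\<Sum>u<r. min j (k u))"
    using fits by (simp add: gale_ryser_def)
  also have "(\<Sum>u<r. min j (k u)) + (\<Sum>u<r. of_bool (k u = Suc j)) = (\<Sum>u<r. k u)"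
  proof -
    have "min j (k u) + of_bool (k u = Suc j) = k u" for u
      using bounded[of u] by auto
    then show ?thesis
      by (simp only: sum.distrib[symmetric])
  qed
  finally show False
    using fits by (simp add: gale_ryser_def)
qed

lemma gale_ryser_shorten:
  assumes fits: "gale_ryser r p (Suc j) k" and heights: "antimono p"
    and greedy: "greedy_rows r k C" and card_C: "card C = p j"
  shows "gale_ryser r p j (shorten C k)"
proof -
  have anti: "antimono k" and zero: "\<And>i. r \<le> i \<Longrightarrow> k i = 0" and bounded: "\<And>i. k i \<le> Suc j"
    and total: "(\<Sum>i<r. k i) = (\<Sum>c<Suc j. p c)"
    and columns: "\<And>y. y \<le> Suc j \<Longrightarrow> (\<Sum>c<y. p c) \<le> (\<Sum>i<r. min y (k i))"
    using fits by (auto simp: gale_ryser_def partition_le_def)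
  have nonempty: "0 < k i" if "i \<in> C" for i
    using greedy_rows_nonempty[OF fits heights greedy card_C that] .
  have "partition_le r (shorten C k)"
    using antimono_shorten[OF greedy anti zero] zero by (simp add: partition_le_def shorten_def)
  moreover have "shorten C k i \<le> j" for i
    using bounded[of i] greedy_rows_full[OF fits greedy card_C, of i]
    by (cases "k i = Suc j") (auto simp: shorten_def)
  moreover have "(\<Sum>i<r. shorten C k i) = (\<Sum>c<j. p c)"
  proof -
    have "shorten C k i + of_bool (i \<in> C) = k i" for i
      using nonempty[of i] by (auto simp: shorten_def)
    then have "(\<Sum>i<r. shorten C k i) + card C = (\<Sum>i<r. k i)"
      by (simp only: sum_of_bool_greedy_rows[OF greedy, symmetric] sum.distrib[symmetric])
    then show ?thesis
      using card_C total by simp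
  qed
  moreover have "(\<Sum>c<y. p c) \<le> (\<Sum>i<r. min y (shorten C k i))" if "y \<le> j" for y
  proof (rule column_sums_le_shorten[OF greedy nonempty])
    show "card C \<le> p y"
      using heights that by (simp add: card_C antimonoD)
  qed (use columns[of y] columns[of "Suc y"] that in simp_all)
  ultimately show ?thesis
    by (simp add: gale_ryser_def)
qed

definition left_justified :: "nat \<Rightarrow> (nat \<Rightarrow> nat) \<Rightarrow> (nat \<Rightarrow> nat \<Rightarrow> int) \<Rightarrow> bool" where
  "left_justified j k M \<longleftrightarrow> (\<forall>i. k i \<le> j) \<and> (\<forall>i. \<forall>c<j. M i c = of_bool (c < k i))"

lemma card_ones_left_justified:
  assumes "left_justified j k M"
  shows "card {c. c < j \<and> M i c = 1} = k i"
proof -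
  have "c < j \<and> M i c = 1 \<longleftrightarrow> c < k i" for c
    using assms less_le_trans[of c "k i" j] by (auto simp: left_justified_def)
  then show ?thesis
    by simp
qed

lemma card_first_elements:
  fixes R :: "'a \<Rightarrow> 'a \<Rightarrow> bool"
  assumes "finite S" and order: "irreflp R" "transp R" "totalp_on S R" and "k \<le> card S"
  shows "card {x \<in> S. card {y \<in> S. R y x} < k} = k"
proof -
  define position where "position x = card {y \<in> S. R y x}" for x
  have mono: "position x < position y" if "x \<in> S" "R x y" for x y
    unfolding position_def
  proof (rule psubset_card_mono)
    show "{z \<in> S. R z x} \<subset> {z \<in> S. R z y}"
      using that order by (auto dest: irreflpD transpD)
  qed (use \<open>finite S\<close> in simp)
  have inj: "inj_on position S"
    using order(3) by (intro inj_onI) (metis mono less_irrefl totalp_onD)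
  have "position x < card S" if "x \<in> S" for x
    unfolding position_def
    by (rule psubset_card_mono) (use \<open>finite S\<close> that order(1) in \<open>auto dest: irreflpD\<close>)
  then have image: "position ` S = {..<card S}"
    by (intro card_subset_eq) (use inj in \<open>auto simp: card_image\<close>)
  have "bij_betw position {x \<in> S. position x < k} {..<k}"
    unfolding bij_betw_def
  proof
    show "inj_on position {x \<in> S. position x < k}"
      using inj by (rule inj_on_subset) blast
    have "position ` {x \<in> S. position x < k} = position ` S \<inter> {..<k}"
      by auto
    then show "position ` {x \<in> S. position x < k} = {..<k}"
      using \<open>k \<le> card S\<close> by (auto simp: image)
  qed
  then show ?thesis
    by (simp add: bij_betw_same_card position_def)
qed

lemma card_chosen_rows:
  assumes "n \<le> r"
  shows "card (chosen_rows r n M j) = n"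
proof -
  have "card {x \<in> {..<r}. card {y \<in> {..<r}. preferred M j y x} < n} = n"
    by (rule card_first_elements)
      (use assms in \<open>auto simp: preferred_def intro!: irreflpI transpI totalp_onI\<close>)
  then show ?thesis
    by (simp add: chosen_rows_def)
qed

lemma greedy_rows_chosen_rows:
  assumes "left_justified (Suc j) k M"
  shows "greedy_rows r k (chosen_rows r n M j)"
proof -
  have ones: "ones_upto M j i = k i" for i
    using card_ones_left_justified[OF assms, of i] by (simp add: ones_upto_def less_Suc_eq_le)
  have "u \<in> chosen_rows r n M j"
    if "s \<in> chosen_rows r n M j" "u < r" "preferred M j u s" for s u
  proof -
    have "card {i. i < r \<and> preferred M j i u} \<le> card {i. i < r \<and> preferred M j i s}"
      by (rule card_mono) (use that(3) in \<open>auto simp: preferred_def\<close>)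
    then show ?thesis
      using that by (auto simp: chosen_rows_def)
  qed
  moreover have "chosen_rows r n M j \<subseteq> {..<r}"
    by (auto simp: chosen_rows_def)
  ultimately show ?thesis
    by (auto simp: greedy_rows_def preferred_def ones)
qed

lemma move_one_right:
  assumes "j < c"
  shows "move_one j R c = R c"
proof (cases "\<exists>c\<le>j. R c = 1")
  case True
  then have "Max {c. c \<le> j \<and> R c = 1} \<in> {c. c \<le> j \<and> R c = 1}"
    by (intro Max_in) auto
  then show ?thesis
    using assms by (auto simp: move_one_def)
next
  case False
  then show ?thesis
    unfolding move_one_def by (subst if_not_P) auto
qed

lemma move_one_left_justified:
  assumes entry: "\<And>c. c \<le> j \<Longrightarrow> R c = of_bool (c < k)" and bounds: "0 < k" "k \<le> Suc j"
  shows "c < j \<Longrightarrow> move_one j R c = of_bool (c < k - 1)"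
    and "move_one j R j = 1"
proof -
  have "\<exists>c\<le>j. R c = 1"
    using entry[of 0] bounds by auto
  moreover have "{c. c \<le> j \<and> R c = 1} = {..<k}"
    using entry bounds by auto
  moreover have "Max {..<k} = k - 1"
    by (rule Max_eqI) (use bounds in auto)
  ultimately have "move_one j R = (R(k - 1 := 0))(j := 1)"
    by (simp add: move_one_def)
  then show "c < j \<Longrightarrow> move_one j R c = of_bool (c < k - 1)" "move_one j R j = 1"
    using entry[of c] bounds by auto
qed

lemma ryser_step_right: "j < c \<Longrightarrow> ryser_step r l j M i c = M i c"
  by (simp add: ryser_step_def move_one_right)

lemma ryser_step_left_justified:
  fixes r j :: nat and l :: "nat \<Rightarrow> nat" and M :: "nat \<Rightarrow> nat \<Rightarrow> int"
  defines "C \<equiv> chosen_rows r (conjugate l j) M j"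
  assumes justified: "left_justified (Suc j) k M"
    and nonempty: "\<And>i. i \<in> C \<Longrightarrow> 0 < k i" and full: "\<And>i. k i = Suc j \<Longrightarrow> i \<in> C"
  shows "left_justified j (shorten C k) (ryser_step r l j M)"
    and "ryser_step r l j M i j = of_bool (i \<in> C)"
proof -
  have bounded: "k i \<le> Suc j" and entry: "\<And>c. c \<le> j \<Longrightarrow> M i c = of_bool (c < k i)" for i
    using justified by (auto simp: left_justified_def less_Suc_eq_le)
  note moved = move_one_left_justified[OF entry nonempty bounded]
  have "shorten C k i \<le> j" for i
    using bounded[of i] full[of i] by (cases "k i = Suc j") (auto simp: shorten_def)
  moreover have "ryser_step r l j M i c = of_bool (c < shorten C k i)" if "c < j" for i c
    using moved(1)[of i] entry[of c i] that by (simp add: ryser_step_def C_def shorten_def)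
  ultimately show "left_justified j (shorten C k) (ryser_step r l j M)"
    by (simp add: left_justified_def)
  have "M i j = 0" if "i \<notin> C"
    using entry[of j i] bounded[of i] full[of i] that by (auto simp: le_Suc_eq)
  then show "ryser_step r l j M i j = of_bool (i \<in> C)"
    using moved(2)[of i] by (simp add: ryser_step_def C_def)
qed

locale kostka_pair =
  fixes r :: nat and l m :: "nat \<Rightarrow> nat"
  assumes in_Kostka: "(l, m) \<in> Kostka r"
begin

definition state :: "nat \<Rightarrow> nat \<Rightarrow> nat \<Rightarrow> int" where
  "state j = fold (ryser_step r l) (rev [j..<l 0]) (initial_matrix r m)"

definition row_length :: "nat \<Rightarrow> nat \<Rightarrow> nat" where
  "row_length j i = card {c. c < j \<and> state j i c = 1}"

definition chosen :: "nat \<Rightarrow> nat set" where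
  "chosen j = chosen_rows r (conjugate l j) (state (Suc j)) j"

lemma partition_l: "partition_le r l" and partition_m: "partition_le r m"
  and sum_l_eq_sum_m: "(\<Sum>i<r. l i) = (\<Sum>i<r. m i)"
  and sum_m_le_sum_l: "(\<Sum>i<t. m i) \<le> (\<Sum>i<t. l i)"
  using in_Kostka by (auto simp: Kostka_def)

lemma l_le: "l i \<le> l 0" and m_le: "m i \<le> l 0"
proof -
  show "l i \<le> l 0"
    using partition_l by (simp add: partition_le_def antimonoD)
  have "m i \<le> m 0"
    using partition_m by (simp add: partition_le_def antimonoD)
  then show "m i \<le> l 0"
    using sum_m_le_sum_l[of 1] by simp
qed

lemma state_step: "j < l 0 \<Longrightarrow> state j = ryser_step r l j (state (Suc j))"
  by (simp add: state_def upt_conv_Cons)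

lemma card_chosen: "card (chosen j) = conjugate l j"
  unfolding chosen_def by (rule card_chosen_rows) (rule conjugate_le[OF partition_l])

lemma row_length_eqI: "left_justified j k (state j) \<Longrightarrow> row_length j = k"
  by (simp add: row_length_def card_ones_left_justified fun_eq_iff)

lemma left_justified_initial: "left_justified (l 0) m (state (l 0))"
  using partition_m m_le
  by (auto simp: left_justified_def state_def initial_matrix_def partition_le_def not_less)

lemma row_length_initial: "row_length (l 0) = m"
  using left_justified_initial by (rule row_length_eqI)

lemma gale_ryser_initial: "gale_ryser r (conjugate l) (l 0) m"
proof -
  have "min (l 0) (l i) = l i" for i
    using l_le[of i] by simp
  then have "(\<Sum>i<r. m i) = (\<Sum>c<l 0. conjugate l c)"
    by (simp add: sum_conjugate[OF partition_l] sum_l_eq_sum_m)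
  moreover have "(\<Sum>c<y. conjugate l c) \<le> (\<Sum>i<r. min y (m i))" for y
    unfolding sum_conjugate[OF partition_l]
    by (rule sum_min_le_of_dominated[OF partition_m sum_l_eq_sum_m sum_m_le_sum_l])
  ultimately show ?thesis
    by (simp add: gale_ryser_def partition_m m_le)
qed

lemma ryser_step_invariant:
  assumes "j < l 0"
    and justified: "left_justified (Suc j) (row_length (Suc j)) (state (Suc j))"
    and fits: "gale_ryser r (conjugate l) (Suc j) (row_length (Suc j))"
  shows "greedy_rows r (row_length (Suc j)) (chosen j)"
    and "state j i j = of_bool (i \<in> chosen j)"
    and "row_length (Suc j) i = row_length j i + of_bool (i \<in> chosen j)"
    and "left_justified j (row_length j) (state j)"
    and "gale_ryser r (conjugate l) j (row_length j)"
proof -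
  let ?k = "row_length (Suc j)"
  note column_heights = antimono_conjugate[OF partition_l]
  show greedy: "greedy_rows r ?k (chosen j)"
    unfolding chosen_def by (rule greedy_rows_chosen_rows[OF justified])
  have nonempty: "0 < ?k i" if "i \<in> chosen j" for i
    using greedy_rows_nonempty[OF fits column_heights greedy card_chosen that] .
  have full: "i \<in> chosen j" if "?k i = Suc j" for i
    using greedy_rows_full[OF fits greedy card_chosen that] .
  note step = ryser_step_left_justified[OF justified, of r l,
      folded chosen_def state_step[OF \<open>j < l 0\<close>]]
  have shortened: "left_justified j (shorten (chosen j) ?k) (state j)"
    using nonempty full by (rule step(1))
  then have row_length_j: "row_length j = shorten (chosen j) ?k"
    by (rule row_length_eqI)
  show "state j i j = of_bool (i \<in> chosen j)"
    using nonempty full by (rule step(2))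
  show "?k i = row_length j i + of_bool (i \<in> chosen j)"
    using nonempty[of i] by (simp add: row_length_j shorten_def)
  show "left_justified j (row_length j) (state j)"
    unfolding row_length_j by (rule shortened)
  show "gale_ryser r (conjugate l) j (row_length j)"
    unfolding row_length_j by (rule gale_ryser_shorten[OF fits column_heights greedy card_chosen])
qed

lemma ryser_invariant:
  assumes "j \<le> l 0"
  shows "left_justified j (row_length j) (state j) \<and> gale_ryser r (conjugate l) j (row_length j)"
  using assms
proof (induction rule: inc_induct)
  case base
  show ?case
    using left_justified_initial gale_ryser_initial by (simp add: row_length_initial)
next
  case (step j)
  then show ?case
    using ryser_step_invariant(4,5) by blast
qed

lemma greedy_rows_chosen: "j < l 0 \<Longrightarrow> greedy_rows r (row_length (Suc j)) (chosen j)"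
  and state_diagonal: "j < l 0 \<Longrightarrow> state j i j = of_bool (i \<in> chosen j)"
  and row_length_Suc: "j < l 0 \<Longrightarrow> row_length (Suc j) i = row_length j i + of_bool (i \<in> chosen j)"
  using ryser_step_invariant(1-3)[of j] ryser_invariant[of "Suc j"] by simp_all

lemma row_length_0: "row_length 0 i = 0"
  by (simp add: row_length_def)

lemma antimono_row_length: "j \<le> l 0 \<Longrightarrow> antimono (row_length j)"
  using ryser_invariant by (simp add: gale_ryser_def partition_le_def)

lemma chosen_subset: "chosen j \<subseteq> {..<r}"
  by (auto simp: chosen_def chosen_rows_def)

lemma canonical_matrix_eq:
  assumes "j < l 0"
  shows "canonical_matrix r l m i j = of_bool (i \<in> chosen j)"
proof -
  have "state d i j = state j i j" if "d \<le> j" for d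
    using that
  proof (induction rule: inc_induct)
    case (step d)
    then have "state d i j = state (Suc d) i j"
      using assms by (simp add: state_step[of d] ryser_step_right)
    with step show ?case
      by simp
  qed simp
  from this[of 0] show ?thesis
    using state_diagonal[OF assms] by (simp add: canonical_matrix_def state_def)
qed

end

section \<open>Pairs from families of columns\<close>

definition shape :: "'c set \<Rightarrow> ('c \<Rightarrow> nat set) \<Rightarrow> nat \<Rightarrow> nat" where
  "shape J C i = card {c \<in> J. i < card (C c)}"

definition row_sums :: "'c set \<Rightarrow> ('c \<Rightarrow> nat set) \<Rightarrow> nat \<Rightarrow> nat" where
  "row_sums J C i = card {c \<in> J. i \<in> C c}"

lemma
  assumes "finite J" "finite K" "J \<inter> K = {}"
  shows shape_Un: "shape (J \<union> K) C = shape J C + shape K C"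
    and row_sums_Un: "row_sums (J \<union> K) C = row_sums J C + row_sums K C"
proof -
  have "card {c \<in> J \<union> K. P c} = card {c \<in> J. P c} + card {c \<in> K. P c}" for P
  proof -
    have "{c \<in> J \<union> K. P c} = {c \<in> J. P c} \<union> {c \<in> K. P c}"
      by auto
    then show ?thesis
      using assms by (auto intro: card_Un_disjoint)
  qed
  then show "shape (J \<union> K) C = shape J C + shape K C"
    "row_sums (J \<union> K) C = row_sums J C + row_sums K C"
    unfolding shape_def row_sums_def by (simp_all only: plus_fun_def)
qed

lemma partition_le_shape:
  assumes "finite J" and rows: "\<And>c. c \<in> J \<Longrightarrow> C c \<subseteq> {..<r}"
  shows "partition_le r (shape J C)"
proof -
  have "card (C c) \<le> r" if "c \<in> J" for c
    using card_mono[OF _ rows[OF that]] by simp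
  then have "shape J C i = 0" if "r \<le> i" for i
    unfolding shape_def card_eq_0_iff using that by force
  moreover have "antimono (shape J C)"
    unfolding shape_def by (intro antimonoI card_mono) (use assms(1) in auto)
  ultimately show ?thesis
    by (simp add: partition_le_def)
qed

text \<open>The easy half of the Gale-Ryser theorem.\<close>

lemma shape_row_sums_in_Kostka:
  assumes "finite J" and rows: "\<And>c. c \<in> J \<Longrightarrow> C c \<subseteq> {..<r}"
    and anti: "antimono (row_sums J C)"
  shows "(shape J C, row_sums J C) \<in> Kostka r"
proof -
  have finite_rows: "finite (C c)" if "c \<in> J" for c
    using rows[OF that] finite_subset by blast
  have "row_sums J C i = 0" if "r \<le> i" for i
    unfolding row_sums_def card_eq_0_iff using rows that by force
  then have "partition_le r (row_sums J C)"
    using anti by (simp add: partition_le_def)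
  moreover have sum_shape: "(\<Sum>i<t. shape J C i) = (\<Sum>c\<in>J. min t (card (C c)))" for t
    unfolding shape_def
    by (rule sum_multicount_gen) (use \<open>finite J\<close> card_less_Int_lessThan in blast)+
  have sum_row_sums: "(\<Sum>i<t. row_sums J C i) = (\<Sum>c\<in>J. card {i \<in> {..<t}. i \<in> C c})" for t
    unfolding row_sums_def by (rule sum_multicount_gen) (use \<open>finite J\<close> in auto)
  have "card {i \<in> {..<r}. i \<in> C c} = min r (card (C c))" if "c \<in> J" for c
  proof -
    have "{i \<in> {..<r}. i \<in> C c} = C c"
      using rows[OF that] by auto
    then show ?thesis
      using card_mono[OF _ rows[OF that]] by simp
  qed
  then have "(\<Sum>i<r. shape J C i) = (\<Sum>i<r. row_sums J C i)"
    unfolding sum_shape sum_row_sums by simp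
  moreover have "(\<Sum>i<t. row_sums J C i) \<le> (\<Sum>i<t. shape J C i)" for t
    unfolding sum_shape sum_row_sums
  proof (rule sum_mono)
    fix c assume "c \<in> J"
    then have "card {i \<in> {..<t}. i \<in> C c} \<le> card (C c)"
      using finite_rows by (intro card_mono) auto
    moreover have "card {i \<in> {..<t}. i \<in> C c} \<le> card {..<t}"
      by (rule card_mono) auto
    ultimately show "card {i \<in> {..<t}. i \<in> C c} \<le> min t (card (C c))"
      by simp
  qed
  ultimately show ?thesis
    using partition_le_shape[OF \<open>finite J\<close> rows] by (simp add: Kostka_def)
qed

context kostka_pair
begin

lemma shape_chosen: "shape {..<l 0} chosen = l"
  using l_le
  by (simp add: shape_def card_chosen less_conjugate_iff[OF partition_l] card_less_Int_lessThan
      min_absorb2 fun_eq_iff del: lessThan_iff)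

lemma row_sums_chosen: "j \<le> l 0 \<Longrightarrow> row_sums {..<j} chosen i = row_length j i"
proof (induction j)
  case 0
  then show ?case
    by (simp add: row_sums_def row_length_0)
next
  case (Suc j)
  have "row_sums ({..<j} \<union> {j}) chosen i = row_sums {..<j} chosen i + row_sums {j} chosen i"
    by (subst row_sums_Un) (simp_all add: plus_fun_def)
  also have "row_sums {j} chosen i = of_bool (i \<in> chosen j)"
    by (simp add: row_sums_def Collect_conv_if)
  finally show ?case
    using Suc by (simp add: row_length_Suc lessThan_Suc)
qed

end

section \<open>Sign patterns of rows and columns\<close>

lemma last_nonzero_summand:
  fixes f :: "nat \<Rightarrow> 'a::comm_monoid_add"
  assumes "sum f {..<j} \<noteq> 0"
  obtains k where "k < j" "f k \<noteq> 0" "\<And>c. k < c \<Longrightarrow> c < j \<Longrightarrow> f c = 0"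
    and "sum f {..<Suc k} = sum f {..<j}"
  using assms
proof (induction j arbitrary: thesis)
  case (Suc j)
  show ?case
  proof (cases "f j = 0")
    case True
    then have "sum f {..<j} \<noteq> 0"
      using Suc.prems(2) by simp
    then obtain k where k: "k < j" "f k \<noteq> 0" "\<And>c. k < c \<Longrightarrow> c < j \<Longrightarrow> f c = 0"
      "sum f {..<Suc k} = sum f {..<j}"
      using Suc.IH by blast
    show ?thesis
      by (rule Suc.prems(1)[of k]) (use k True in \<open>auto simp: less_Suc_eq\<close>)
  next
    case False
    then show ?thesis
      by (intro Suc.prems(1)[of j]) auto
  qed
qed simp

lemma ascent_between:
  assumes "a \<notin> S" "b \<in> S" "a < b"
  obtains x where "x \<notin> S" "Suc x \<in> S"
  using ex_least_nat_less[of "\<lambda>d. a + d \<in> S" "b - a"] assms by auto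

lemma ex_descent:
  assumes "finite S" "S \<noteq> {}"
  obtains x where "x \<in> S" "Suc x \<notin> S"
  using Max_in[OF assms] Max_ge[OF assms(1), of "Suc (Max S)"] by (metis Suc_n_not_le_n)

lemma greedy_rows_ascent_unique:
  assumes greedy: "greedy_rows r k C" and anti: "antimono k"
    and ascents: "i \<notin> C" "Suc i \<in> C" "i' \<notin> C" "Suc i' \<in> C"
  shows "i = i'"
proof -
  have False if "i < i'" "i \<notin> C" "Suc i \<in> C" "i' \<notin> C" "Suc i' \<in> C" for i i'
  proof -
    have tied: "k x = k (Suc i')" if "i \<le> x" "x \<le> Suc i'" for x
      using greedy_rows_tied[OF greedy anti \<open>Suc i' \<in> C\<close> \<open>i \<notin> C\<close> that] .
    have "i' < r"
      using greedy_rows_subset[OF greedy] \<open>Suc i' \<in> C\<close> by auto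
    then have "i' \<in> C"
      using greedy_rows_southern[OF greedy \<open>Suc i \<in> C\<close>, of i'] tied[of "Suc i"] tied[of i'] \<open>i < i'\<close>
      by simp
    with \<open>i' \<notin> C\<close> show False
      by simp
  qed
  then show ?thesis
    using ascents by (metis linorder_neqE_nat)
qed

context kostka_pair
begin

abbreviation star :: "nat \<Rightarrow> nat \<Rightarrow> int" where
  "star \<equiv> star_matrix r l m"

abbreviation kgr :: "(nat \<times> nat) pair_pre_digraph" where
  "kgr \<equiv> kgr_graph r l m"

abbreviation vertices :: "(nat \<times> nat) set" where
  "vertices \<equiv> kgr_verts r l m"

abbreviation horizontal_arcs :: "(nat \<times> nat) rel" where
  "horizontal_arcs \<equiv> kgr_horizontal r l m"

abbreviation vertical_arcs :: "(nat \<times> nat) rel" where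
  "vertical_arcs \<equiv> kgr_vertical r l m"

lemma star_eq:
  assumes "j < l 0"
  shows "star i j = of_bool (i \<in> chosen j) - of_bool (Suc i \<in> chosen j)"
  using assms by (simp add: star_matrix_def canonical_matrix_eq)

lemma star_eq_1_iff: "j < l 0 \<Longrightarrow> star i j = 1 \<longleftrightarrow> i \<in> chosen j \<and> Suc i \<notin> chosen j"
  and star_eq_neg1_iff: "j < l 0 \<Longrightarrow> star i j = -1 \<longleftrightarrow> i \<notin> chosen j \<and> Suc i \<in> chosen j"
  and star_cases: "j < l 0 \<Longrightarrow> star i j \<noteq> 0 \<Longrightarrow> star i j = 1 \<or> star i j = -1"
  by (auto simp: star_eq)

lemma mem_vertices_iff: "(i, j) \<in> vertices \<longleftrightarrow> j < l 0 \<and> star i j \<noteq> 0"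
proof -
  have "i < r" if "j < l 0" "star i j \<noteq> 0"
    using that chosen_subset[of j] by (auto simp: star_eq of_bool_def split: if_splits)
  then show ?thesis
    by (auto simp: kgr_verts_def)
qed

lemma chosen_tied:
  assumes "j < l 0" "s \<in> chosen j" "u \<notin> chosen j" "u \<le> i" "i \<le> s"
  shows "row_length (Suc j) i = row_length (Suc j) s"
  by (rule greedy_rows_tied[OF greedy_rows_chosen antimono_row_length]) (use assms in auto)

lemma sum_star:
  assumes "j \<le> l 0"
  shows "(\<Sum>c<j. star i c) = int (row_length j i) - int (row_length j (Suc i))"
  using assms by (induction j) (auto simp: star_eq row_length_Suc row_length_0)

lemma sum_star_neg1:
  assumes "j < l 0" "star i j = -1"
  shows "(\<Sum>c<j. star i c) = 1" "(\<Sum>c<Suc j. star i c) = 0"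
proof -
  have "i \<notin> chosen j" "Suc i \<in> chosen j"
    using assms by (simp_all add: star_eq_neg1_iff)
  then have "row_length (Suc j) i = row_length (Suc j) (Suc i)"
    using chosen_tied[of j "Suc i" i i] assms(1) by simp
  then show "(\<Sum>c<Suc j. star i c) = 0"
    using sum_star[of "Suc j" i] assms(1) by simp
  then show "(\<Sum>c<j. star i c) = 1"
    using assms(2) by simp
qed

text \<open>
  The partial row sums drop to 0 at every -1, so they equal 1 just before it and the last
  nonzero entry before it cannot be another -1.
\<close>

lemma neg1_preceded_by_1:
  assumes neg1: "j < l 0" "star i j = -1"
  obtains k where "k < j" "star i k = 1" "\<And>c. k < c \<Longrightarrow> c < j \<Longrightarrow> star i c = 0"
proof -
  obtain k where k: "k < j" "star i k \<noteq> 0" "\<And>c. k < c \<Longrightarrow> c < j \<Longrightarrow> star i c = 0"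
    and "(\<Sum>c<Suc k. star i c) = (\<Sum>c<j. star i c)"
    using last_nonzero_summand[of "star i" j] sum_star_neg1(1)[OF neg1] by (metis zero_neq_one)
  then have "star i k \<noteq> -1"
    using sum_star_neg1(2)[of k i] sum_star_neg1(1)[OF neg1] neg1(1) by auto
  then show thesis
    using that k star_cases[of k i] neg1(1) by auto
qed

lemma horizontal_iff:
  "((i, j), (i', k)) \<in> horizontal_arcs \<longleftrightarrow>
     i' = i \<and> j < l 0 \<and> star i j = -1 \<and> k < j \<and> star i k = 1 \<and>
     (\<forall>c. k < c \<and> c < j \<longrightarrow> star i c = 0)"
  (is "?L \<longleftrightarrow> ?R")
proof
  assume ?L
  then have ends: "i' = i" "j < l 0" "star i j = -1" "k < j" "star i k = 1"
    and no1: "\<And>c. k < c \<Longrightarrow> c < j \<Longrightarrow> star i c \<noteq> 1"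
    by (auto simp: kgr_horizontal_def mem_vertices_iff)
  obtain k' where k': "k' < j" "star i k' = 1" "\<And>c. k' < c \<Longrightarrow> c < j \<Longrightarrow> star i c = 0"
    using neg1_preceded_by_1[OF ends(2,3)] by blast
  have "k' = k"
    using no1[of k'] k'(1,2) k'(3)[of k] ends(4,5) by (cases k k' rule: linorder_cases) auto
  then show ?R
    using ends k' by simp
next
  assume ?R
  then show ?L
    by (auto simp: kgr_horizontal_def mem_vertices_iff)
qed

lemma vertical_iff:
  "((i, j), (k, j')) \<in> vertical_arcs \<longleftrightarrow>
     j' = j \<and> j < l 0 \<and> star i j = 1 \<and> star k j = -1"
  by (auto simp: kgr_vertical_def mem_vertices_iff)

lemma horizontal_exists:
  assumes "j < l 0" "star i j = -1"
  obtains k where "((i, j), (i, k)) \<in> horizontal_arcs"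
  using neg1_preceded_by_1[OF assms] assms by (metis horizontal_iff)

lemma horizontal_unique_target:
  assumes "((i, j), (i', k)) \<in> horizontal_arcs" "((i, j), (i'', k')) \<in> horizontal_arcs"
  shows "k = k'"
  using assms unfolding horizontal_iff by (cases k k' rule: linorder_cases) auto

lemma horizontal_unique_source:
  assumes "((i, j), (i', k)) \<in> horizontal_arcs" "((i, j'), (i'', k)) \<in> horizontal_arcs"
  shows "j = j'"
  using assms unfolding horizontal_iff by (cases j j' rule: linorder_cases) auto

lemma neg1_unique_in_column:
  assumes "j < l 0" "star i j = -1" "star i' j = -1"
  shows "i = i'"
  by (rule greedy_rows_ascent_unique[OF greedy_rows_chosen antimono_row_length])
    (use assms in \<open>auto simp: star_eq_neg1_iff\<close>)

lemma column_without_neg1: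
  assumes j: "j < l 0" and "\<And>x. star x j \<noteq> -1" "star i j = 1" "star i' j = 1"
  shows "i = i'"
proof -
  have "i' \<le> i" if "star i j = 1" "star i' j = 1" for i i'
  proof (rule ccontr)
    assume "\<not> i' \<le> i"
    moreover have "Suc i \<notin> chosen j" "i' \<in> chosen j"
      using that j by (auto simp: star_eq_1_iff)
    ultimately obtain x where "x \<notin> chosen j" "Suc x \<in> chosen j"
      using ascent_between[of "Suc i" "chosen j" i'] by (metis linorder_neqE_nat not_less_eq not_le)
    then show False
      using assms(2)[of x] j by (simp add: star_eq_neg1_iff)
  qed
  then show ?thesis
    using assms(3,4) by (meson antisym)
qed

lemma column_has_vertex:
  assumes "j < l 0"
  obtains i where "(i, j) \<in> vertices"
proof -
  have "finite (chosen j)"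
    using chosen_subset finite_subset by blast
  moreover have "chosen j \<noteq> {}"
    using less_conjugate_iff[OF partition_l, of 0 j] assms card_chosen[of j] by auto
  ultimately obtain i where "i \<in> chosen j" "Suc i \<notin> chosen j"
    by (rule ex_descent)
  then show thesis
    using that[of i] assms by (simp add: mem_vertices_iff star_eq)
qed

lemma row_length_inside_horizontal:
  assumes "((i, j), (i', k)) \<in> horizontal_arcs" "k < c" "c < j"
  shows "row_length (Suc c) i \<noteq> row_length (Suc c) (Suc i)"
proof -
  have neg1: "j < l 0" "star i j = -1" and zero: "\<And>c. k < c \<Longrightarrow> c < j \<Longrightarrow> star i c = 0"
    using assms(1) by (auto simp: horizontal_iff)
  have "(\<Sum>c<Suc c. star i c) = (\<Sum>c<j. star i c)"
    by (rule sum.mono_neutral_left) (use assms zero in auto)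
  then show ?thesis
    using sum_star[of "Suc c" i] sum_star_neg1(1)[OF neg1] assms neg1 by simp
qed

lemma row_length_inside_vertical:
  assumes arc: "((i, c), (k, c)) \<in> vertical_arcs" and inside: "min i k < x" "x < max i k"
  shows "row_length (Suc c) x = row_length (Suc c) (Suc x)"
proof -
  have "c < l 0" and descent: "i \<in> chosen c" "Suc i \<notin> chosen c"
    and ascent: "k \<notin> chosen c" "Suc k \<in> chosen c"
    using arc by (auto simp: vertical_iff star_eq_1_iff star_eq_neg1_iff)
  note tied = chosen_tied[OF \<open>c < l 0\<close>]
  show ?thesis
  proof (cases "i < k")
    case True
    then show ?thesis
      using tied[OF ascent(2) descent(2), of x] tied[OF ascent(2) descent(2), of "Suc x"] inside
      by simp
  next
    case False
    then show ?thesis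
      using tied[OF descent(1) ascent(1), of x] tied[OF descent(1) ascent(1), of "Suc x"] inside
      by simp
  qed
qed

lemma star_inside_vertical:
  assumes arc: "((i, c), (k, c)) \<in> vertical_arcs" and inside: "min i k < x" "x < max i k"
  shows "star x c = 0"
proof (rule ccontr)
  assume nonzero: "star x c \<noteq> 0"
  have "c < l 0" and rows: "i \<in> chosen c" "Suc k \<in> chosen c" and neg1: "star k c = -1"
    using arc by (auto simp: vertical_iff star_eq_1_iff star_eq_neg1_iff)
  have "star x c \<noteq> -1"
    using neg1_unique_in_column[OF \<open>c < l 0\<close> neg1, of x] inside by auto
  then have descent: "x \<in> chosen c" "Suc x \<notin> chosen c"
    using star_cases[OF \<open>c < l 0\<close> nonzero] \<open>c < l 0\<close> by (auto simp: star_eq_1_iff)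
  have "Suc x < r"
    using chosen_subset[of c] rows inside by (auto simp: max_def split: if_splits)
  then show False
    using greedy_rows_southern[OF greedy_rows_chosen[OF \<open>c < l 0\<close>] descent(1), of "Suc x"]
      descent(2) row_length_inside_vertical[OF arc inside] by simp
qed

end

section \<open>Forests and components\<close>

lemma mem_graph_sources_iff:
  "v \<in> graph_sources G \<longleftrightarrow> v \<in> pverts G \<and> (\<forall>u. (u, v) \<notin> parcs G)"
  by (force simp: graph_sources_def in_arcs_def)

lemma mem_graph_sinks_iff:
  "v \<in> graph_sinks G \<longleftrightarrow> v \<in> pverts G \<and> (\<forall>w. (v, w) \<notin> parcs G)"
  by (force simp: graph_sinks_def out_arcs_def)

lemma wf_digraph_with_projD:
  assumes "wf_digraph (with_proj G)" "(u, v) \<in> parcs G"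
  shows "u \<in> pverts G" "v \<in> pverts G"
  using wf_digraph.tail_in_verts[OF assms(1), of "(u, v)"]
    wf_digraph.head_in_verts[OF assms(1), of "(u, v)"] assms(2) by auto

lemma unique_sink_reachable:
  assumes wf_digraph: "wf_digraph (with_proj G)" and wf: "wf ((parcs G)\<inverse>)"
    and sink: "graph_sinks G = {s}" and v: "v \<in> pverts G"
  shows "(v, s) \<in> (parcs G)\<^sup>*"
  using wf v
proof (induction v rule: wf_induct_rule)
  case (less v)
  show ?case
  proof (cases "v = s")
    case False
    then obtain w where w: "(v, w) \<in> parcs G"
      using sink less.prems mem_graph_sinks_iff[of v G] by blast
    then have "(w, s) \<in> (parcs G)\<^sup>*"
      using less.IH wf_digraph_with_projD(2)[OF wf_digraph] by blast
    with w show ?thesis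
      by (rule converse_rtrancl_into_rtrancl)
  qed simp
qed

lemma pcas_closed_rotate1:
  assumes "pcas u p u"
  shows "map snd p = rotate1 (map fst p)"
proof -
  have "pcas v p w \<Longrightarrow> v # map snd p = map fst p @ [w]" for v w
    by (induction p arbitrary: v) auto
  then show ?thesis
    using assms by (cases p) force+
qed

lemma cycle_vertex_sequence:
  fixes G :: "'a pair_pre_digraph"
  assumes "pre_digraph.cycle (with_proj G) p"
  obtains a :: "nat \<Rightarrow> 'a" where "p \<noteq> []" "finite (range a)"
    and "\<And>i. (a i, a (Suc i)) \<in> parcs G"
    and "\<And>i j. a i = a j \<longleftrightarrow> i mod length p = j mod length p"
proof -
  obtain u where walk: "pre_digraph.awalk (with_proj G) u p u"
    "distinct (tl (pre_digraph.awalk_verts (with_proj G) u p))" and "p \<noteq> []"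
    using assms unfolding pre_digraph.cycle_def by blast
  have cas: "pre_digraph.cas (with_proj G) u p u" and arcs: "set p \<subseteq> parcs G"
    using walk(1) by (auto simp: pre_digraph.awalk_def)
  have rotate: "map snd p = rotate1 (map fst p)"
    using cas by (intro pcas_closed_rotate1) (simp add: cas_with_proj_eq)
  have "distinct (map snd p)"
    using walk(2) \<open>p \<noteq> []\<close> by (simp add: pre_digraph.awalk_verts_conv'[OF cas])
  then have distinct: "distinct (map fst p)"
    unfolding rotate by simp
  define a where "a i = map fst p ! (i mod length p)" for i
  have "a i \<in> set (map fst p)" for i
    unfolding a_def using \<open>p \<noteq> []\<close> by (intro nth_mem) simp
  then have "finite (range a)"
    by (meson finite_set finite_subset image_subsetI)
  moreover have "a i = a j \<longleftrightarrow> i mod length p = j mod length p" for i j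
    unfolding a_def using nth_eq_iff_index_eq[OF distinct] \<open>p \<noteq> []\<close> by simp
  moreover have "(a i, a (Suc i)) \<in> parcs G" for i
  proof -
    have "snd (p ! (i mod length p)) = rotate1 (map fst p) ! (i mod length p)"
      unfolding rotate[symmetric] using \<open>p \<noteq> []\<close> by simp
    also have "\<dots> = a (Suc i)"
      using \<open>p \<noteq> []\<close> by (simp add: a_def nth_rotate1 mod_Suc_eq del: rotate1_map)
    finally have "(a i, a (Suc i)) = p ! (i mod length p)"
      using \<open>p \<noteq> []\<close> by (simp add: a_def prod_eq_iff)
    then show ?thesis
      using arcs nth_mem[of "i mod length p" p] \<open>p \<noteq> []\<close> by auto
  qed
  ultimately show thesis
    using that \<open>p \<noteq> []\<close> by blast
qed

lemma mem_parcs_mk_symmetric_iff: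
  "(u, v) \<in> parcs (mk_symmetric (with_proj G)) \<longleftrightarrow> (u, v) \<in> parcs G \<or> (v, u) \<in> parcs G"
  by (auto simp: parcs_mk_symmetric Bex_def)

lemma ex_minimal_of_acyclic:
  assumes "acyclic R" "finite A" "A \<noteq> {}"
  obtains z where "z \<in> A" "\<And>y. y \<in> A \<Longrightarrow> (y, z) \<notin> R"
proof -
  have "acyclic (R \<inter> A \<times> A)"
    using assms(1) by (rule acyclic_subset) simp
  then have "wf (R \<inter> A \<times> A)"
    using assms(2) by (simp add: finite_acyclic_wf)
  then obtain z where "z \<in> A" "\<And>y. (y, z) \<in> R \<inter> A \<times> A \<Longrightarrow> y \<notin> A"
    using assms(3) by (metis all_not_in_conv wfE_min)
  then show thesis
    using that by blast
qed

text \<open>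
  At a vertex of an undirected cycle that no arc from the cycle enters, both cycle edges lead
  out of it.
\<close>

lemma undirected_forest_of_acyclic_single_valued:
  assumes acyclic: "acyclic (parcs G)" and functional: "single_valued (parcs G)"
  shows "undirected_forest G"
  unfolding undirected_forest_def
proof
  assume "\<exists>p. pre_digraph.cycle (with_proj (mk_symmetric (with_proj G))) p \<and> length p \<noteq> 2"
  then obtain p where cycle: "pre_digraph.cycle (with_proj (mk_symmetric (with_proj G))) p"
    and "length p \<noteq> 2"
    by blast
  obtain a where "p \<noteq> []" and "finite (range a)"
    and edge: "\<And>i. (a i, a (Suc i)) \<in> parcs (mk_symmetric (with_proj G))"
    and a_eq: "\<And>i j. a i = a j \<longleftrightarrow> i mod length p = j mod length p"
    by (rule cycle_vertex_sequence[OF cycle]) (rule that)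
  then obtain z where "z \<in> range a" "\<And>y. y \<in> range a \<Longrightarrow> (y, z) \<notin> parcs G"
    using ex_minimal_of_acyclic[OF acyclic, of "range a"] by blast
  then obtain i where minimal: "\<And>j. (a j, a i) \<notin> parcs G"
    by blast
  define prev where "prev = i + length p - 1"
  have prev: "a (Suc prev) = a i"
    using \<open>p \<noteq> []\<close> by (simp add: prev_def a_eq)
  have "(a i, a prev) \<in> parcs G" "(a i, a (Suc i)) \<in> parcs G"
    using edge[of prev] edge[of i] minimal prev by (auto simp: mem_parcs_mk_symmetric_iff)
  with functional have "a prev = a (Suc i)"
    by (rule single_valuedD)
  then have "prev mod length p = Suc i mod length p"
    by (simp add: a_eq)
  then have "Suc (Suc i) mod length p = Suc prev mod length p"
    by (metis mod_Suc_eq)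
  also have "\<dots> = i mod length p"
    using prev by (simp add: a_eq)
  finally have "length p dvd 2"
    by (simp add: mod_eq_dvd_iff_nat)
  then have "length p = 1"
    using dvd_imp_le[of "length p" 2] \<open>p \<noteq> []\<close> \<open>length p \<noteq> 2\<close> by (cases "length p") auto
  then have "(a i, a i) \<in> parcs G"
    using \<open>(a i, a (Suc i)) \<in> parcs G\<close> a_eq[of i "Suc i"] by simp
  with minimal show False
    by blast
qed

lemma connected_union:
  assumes wf: "wf_digraph G" "wf_digraph H" and "compatible G H"
    and connected: "Digraph_Component.connected G" "Digraph_Component.connected H"
    and meet: "verts G \<inter> verts H \<noteq> {}"
  shows "Digraph_Component.connected (union G H)"
proof -
  interpret G: pair_wf_digraph "mk_symmetric G"
    using wf(1) by (rule wf_digraph.wellformed_mk_symmetric)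
  interpret H: pair_wf_digraph "mk_symmetric H"
    using wf(2) by (rule wf_digraph.wellformed_mk_symmetric)
  have "strongly_connected (union (with_proj (mk_symmetric G)) (with_proj (mk_symmetric H)))"
    by (rule strongly_connected_non_disj[OF G.wf_digraph_axioms H.wf_digraph_axioms])
      (use connected meet in \<open>auto simp: connected_def\<close>)
  moreover have "union (with_proj (mk_symmetric G)) (with_proj (mk_symmetric H)) =
      with_proj (mk_symmetric (union G H))"
    using \<open>compatible G H\<close> by (auto simp: union_def with_proj_def mk_symmetric_def compatible_def)
  ultimately show ?thesis
    by (simp add: connected_def)
qed

lemma max_connected_subgraph_absorbs:
  assumes max: "pre_digraph.max_subgraph G Digraph_Component.connected H"
    and connected: "subgraph K G" "Digraph_Component.connected K" "verts H \<inter> verts K \<noteq> {}"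
  shows "verts K \<subseteq> verts H" "arcs K \<subseteq> arcs H"
proof -
  have H: "subgraph H G" "Digraph_Component.connected H"
    using max by (auto simp: pre_digraph.max_subgraph_def)
  then have compatible: "compatible H K" and wf: "wf_digraph H" "wf_digraph K"
    using connected(1) by (auto simp: subgraph_def compatible_def)
  have "Digraph_Component.connected (union H K)"
    using wf compatible H(2) connected(2,3) by (rule connected_union)
  moreover have "subgraph H (union H K)"
    using subgraphs_of_union[OF wf compatible] by simp
  moreover have "subgraph (union H K) G"
    using subgraph_union_iff[OF wf compatible] H(1) connected(1) by blast
  ultimately have "union H K = H"
    using max by (auto simp: pre_digraph.max_subgraph_def)
  then show "verts K \<subseteq> verts H" "arcs K \<subseteq> arcs H"
    by (metis verts_union arcs_union Un_upper2)+
qed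

lemma wf_digraph_single_arc: "wf_digraph (with_proj \<lparr>pverts = {u, v}, parcs = {(u, v)}\<rparr>)"
  by unfold_locales auto

lemma connected_single_arc:
  "Digraph_Component.connected (with_proj \<lparr>pverts = {u, v}, parcs = {(u, v)}\<rparr>)"
  (is "Digraph_Component.connected (with_proj ?K)")
proof -
  interpret K: pair_wf_digraph "mk_symmetric (with_proj ?K)"
    using wf_digraph_single_arc by (rule wf_digraph.wellformed_mk_symmetric)
  have "x \<rightarrow>\<^sup>*\<^bsub>with_proj (mk_symmetric (with_proj ?K))\<^esub> y" if "x \<in> {u, v}" "y \<in> {u, v}" for x y
    using that by (cases "x = y") (auto intro!: K.reachable_adjI simp: mem_parcs_mk_symmetric_iff)
  then show ?thesis
    by (intro wf_digraph.connectedI[OF wf_digraph_single_arc]) auto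
qed

lemma component_contains_arc:
  assumes component: "connected_component_of H G" and arc: "(u, v) \<in> parcs G"
    and meet: "u \<in> pverts H \<or> v \<in> pverts H"
  shows "u \<in> pverts H" "v \<in> pverts H" "(u, v) \<in> parcs H"
proof -
  let ?K = "\<lparr>pverts = {u, v}, parcs = {(u, v)}\<rparr>"
  have max: "pre_digraph.max_subgraph (with_proj G) Digraph_Component.connected (with_proj H)"
    using component by (simp add: connected_component_of_def)
  then have "wf_digraph (with_proj G)"
    by (auto simp: pre_digraph.max_subgraph_def)
  then have "subgraph (with_proj ?K) (with_proj G)"
    using arc wf_digraph_single_arc wf_digraph_with_projD
    by (fastforce simp: subgraph_def compatible_def)
  then have "verts (with_proj ?K) \<subseteq> verts (with_proj H)" "arcs (with_proj ?K) \<subseteq> arcs (with_proj H)"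
    using max_connected_subgraph_absorbs[OF max _ connected_single_arc] meet by auto
  then show "u \<in> pverts H" "v \<in> pverts H" "(u, v) \<in> parcs H"
    by auto
qed

lemma component_eq_of_spanning:
  assumes component: "connected_component_of H G" and "pverts H = pverts G"
  shows "H = G"
proof -
  have subset: "subgraph (with_proj H) (with_proj G)"
    using component by (auto simp: connected_component_of_def pre_digraph.max_subgraph_def)
  have "(u, v) \<in> parcs H" if "(u, v) \<in> parcs G" for u v
    using component_contains_arc(3)[OF component that] wf_digraph_with_projD(1)[OF _ that]
      subset assms(2)
    by (auto simp: subgraph_def)
  then have "parcs H = parcs G"
    using subset by (auto simp: subgraph_def)
  with assms(2) show ?thesis
    by simp
qed

section \<open>The KGR graph as a plane forest\<close>

abbreviation arc_segment :: "nat \<times> nat \<Rightarrow> nat \<times> nat \<Rightarrow> (real \<times> real) set" where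
  "arc_segment u v \<equiv> closed_segment (matrix_position u) (matrix_position v)"

lemma closed_segment_horizontal:
  fixes a b y :: real
  shows "closed_segment (a, y) (b, y) = closed_segment a b \<times> {y}"
  by (force simp: closed_segment_def algebra_simps)

lemma closed_segment_vertical:
  fixes a b x :: real
  shows "closed_segment (x, a) (x, b) = {x} \<times> closed_segment a b"
  by (force simp: closed_segment_def algebra_simps)

lemma mem_arc_segment_horizontal:
  "k \<le> j \<Longrightarrow> (x, y) \<in> arc_segment (i, j) (i, k) \<longleftrightarrow> real k \<le> x \<and> x \<le> real j \<and> y = - real i"
  by (auto simp: matrix_position_def closed_segment_horizontal closed_segment_eq_real_ivl)

lemma mem_arc_segment_vertical:
  "(x, y) \<in> arc_segment (i, c) (k, c) \<longleftrightarrow>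
     x = real c \<and> - real (max i k) \<le> y \<and> y \<le> - real (min i k)"
  by (auto simp: matrix_position_def closed_segment_vertical closed_segment_eq_real_ivl)

context kostka_pair
begin

lemma pverts_kgr: "pverts kgr = vertices"
  and parcs_kgr: "parcs kgr = horizontal_arcs \<union> vertical_arcs"
  by (simp_all add: kgr_graph_def)

lemma kgr_arc_cases:
  assumes "(u, v) \<in> parcs kgr"
  obtains (horizontal) i j k where "u = (i, j)" "v = (i, k)" "((i, j), (i, k)) \<in> horizontal_arcs"
    | (vertical) i k c where "u = (i, c)" "v = (k, c)" "((i, c), (k, c)) \<in> vertical_arcs"
  using assms by (cases u; cases v) (auto simp: parcs_kgr horizontal_iff vertical_iff)

lemma single_valued_parcs_kgr: "single_valued (parcs kgr)"
proof (rule single_valuedI)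
  fix u v w assume uv: "(u, v) \<in> parcs kgr" and uw: "(u, w) \<in> parcs kgr"
  from uv show "v = w"
  proof (cases rule: kgr_arc_cases)
    case uv_horizontal: (horizontal i j k)
    from uw show ?thesis
    proof (cases rule: kgr_arc_cases)
      case (horizontal i' j' k')
      then show ?thesis
        using uv_horizontal horizontal_unique_target by blast
    qed (use uv_horizontal in \<open>simp add: horizontal_iff vertical_iff\<close>)
  next
    case uv_vertical: (vertical i k c)
    from uw show ?thesis
    proof (cases rule: kgr_arc_cases)
      case (vertical i' k' c')
      then show ?thesis
        using uv_vertical neg1_unique_in_column[of c k k'] by (simp add: vertical_iff)
    qed (use uv_vertical in \<open>simp add: horizontal_iff vertical_iff\<close>)
  qed
qed

lemma wf_converse_parcs_kgr: "wf ((parcs kgr)\<inverse>)"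
proof (rule wf_subset[OF wf_measure])
  show "(parcs kgr)\<inverse> \<subseteq> Wellfounded.measure (\<lambda>(i, j). 2 * j + of_bool (star i j = 1))"
    by (auto elim!: kgr_arc_cases simp: horizontal_iff vertical_iff)
qed

lemma acyclic_parcs_kgr: "acyclic (parcs kgr)"
  using wf_acyclic[OF wf_converse_parcs_kgr] by simp

lemma undirected_forest_subgraph:
  assumes "parcs H \<subseteq> parcs kgr"
  shows "undirected_forest H"
  using undirected_forest_of_acyclic_single_valued acyclic_subset[OF acyclic_parcs_kgr assms]
    single_valued_subset[OF assms single_valued_parcs_kgr] by blast

lemma vertex_on_arc:
  assumes arc: "(u, v) \<in> parcs kgr" and w: "w \<in> vertices"
    and on_arc: "matrix_position w \<in> arc_segment u v"
  shows "w \<in> {u, v}"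
proof -
  obtain x c where w_eq: "w = (x, c)"
    by (cases w)
  from w have nonzero: "star x c \<noteq> 0"
    by (simp add: w_eq mem_vertices_iff)
  have pos_w: "matrix_position w = (real c, - real x)"
    by (simp add: w_eq matrix_position_def)
  from arc show ?thesis
  proof (cases rule: kgr_arc_cases)
    case (horizontal i j k)
    then have "k \<le> j" and zero: "\<And>c. k < c \<Longrightarrow> c < j \<Longrightarrow> star i c = 0"
      by (auto simp: horizontal_iff)
    then have "x = i" "k \<le> c" "c \<le> j"
      using on_arc horizontal(1,2) by (auto simp: mem_arc_segment_horizontal pos_w)
    then show ?thesis
      using zero[of c] nonzero horizontal(1,2) w_eq by (auto simp: le_less)
  next
    case (vertical i k d)
    then have "c = d" "min i k \<le> x" "x \<le> max i k"
      using on_arc by (auto simp: mem_arc_segment_vertical pos_w)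
    then show ?thesis
      using star_inside_vertical[OF vertical(3), of x] nonzero vertical(1,2) w_eq
      by (cases "min i k < x \<and> x < max i k") (auto simp: min_def max_def split: if_splits)
  qed
qed

lemma horizontal_arcs_disjoint:
  assumes arcs: "((i, j), (i, k)) \<in> horizontal_arcs" "((i', j'), (i', k')) \<in> horizontal_arcs"
    and neq: "(i, j) \<noteq> (i', j')"
  shows "arc_segment (i, j) (i, k) \<inter> arc_segment (i', j') (i', k') = {}"
proof -
  have before: "b < c" if "((i, b), (i, a)) \<in> horizontal_arcs"
    "((i, d), (i, c)) \<in> horizontal_arcs" "b < d" for a b c d
    using that unfolding horizontal_iff by (cases b c rule: linorder_cases) auto
  have "k < j" "k' < j'"
    using arcs by (simp_all add: horizontal_iff)
  moreover have "j < k' \<or> j' < k" if "i = i'"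
    using before[of j k j' k'] before[of j' k' j k] arcs neq that
    by (cases j j' rule: linorder_cases) auto
  ultimately show ?thesis
    by (fastforce simp: mem_arc_segment_horizontal)
qed

lemma vertical_arcs_opposite:
  assumes arcs: "((a, c), (b, c)) \<in> vertical_arcs" "((a', c), (b, c)) \<in> vertical_arcs"
    and "a < a'"
  shows "a < b \<and> b < a'"
proof -
  have "a \<noteq> b" "a' \<noteq> b" "star a c \<noteq> 0" "star a' c \<noteq> 0"
    using arcs by (auto simp: vertical_iff)
  moreover from this have "\<not> (min a b < a' \<and> a' < max a b)" "\<not> (min a' b < a \<and> a < max a' b)"
    using star_inside_vertical[OF arcs(1), of a'] star_inside_vertical[OF arcs(2), of a] by blast+
  ultimately show ?thesis
    using \<open>a < a'\<close> by arith
qed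

lemma vertical_arcs_meet:
  assumes arcs: "((a, c), (b, c)) \<in> vertical_arcs" "((a', c'), (b', c')) \<in> vertical_arcs"
    and neq: "(a, c) \<noteq> (a', c')"
  shows "arc_segment (a, c) (b, c) \<inter> arc_segment (a', c') (b', c')
    \<subseteq> matrix_position ` ({(a, c), (b, c)} \<inter> {(a', c'), (b', c')})"
proof
  fix p assume p: "p \<in> arc_segment (a, c) (b, c) \<inter> arc_segment (a', c') (b', c')"
  obtain x y where xy: "p = (x, y)"
    by (cases p)
  have "c' = c"
    using p by (auto simp: xy mem_arc_segment_vertical)
  moreover from this have "b' = b"
    using arcs neg1_unique_in_column by (auto simp: vertical_iff)
  ultimately have "a < b \<and> b < a' \<or> a' < b \<and> b < a"
    using vertical_arcs_opposite[of a c b a'] vertical_arcs_opposite[of a' c b a] arcs neq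
    by (cases a a' rule: linorder_cases) auto
  then have "x = real c" "y = - real b"
    using p by (auto simp: xy mem_arc_segment_vertical \<open>b' = b\<close>)
  then have "p = matrix_position (b, c)"
    by (simp add: xy matrix_position_def)
  then show "p \<in> matrix_position ` ({(a, c), (b, c)} \<inter> {(a', c'), (b', c')})"
    by (simp add: \<open>c' = c\<close> \<open>b' = b\<close>)
qed

text \<open>
  Strictly inside a horizontal arc the rows \<open>i\<close> and \<open>i + 1\<close> have different lengths, whereas
  strictly inside a vertical arc consecutive rows are tied.
\<close>

lemma crossing_is_vertex:
  assumes horizontal: "((i, j), (i, k)) \<in> horizontal_arcs"
    and vertical: "((a, c), (b, c)) \<in> vertical_arcs"
    and "k \<le> c" "c \<le> j" "min a b \<le> i" "i \<le> max a b"
  shows "(i, c) \<in> vertices"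
proof (rule ccontr)
  assume no_vertex: "(i, c) \<notin> vertices"
  have "(i, j) \<in> vertices" "(i, k) \<in> vertices" "(a, c) \<in> vertices" "(b, c) \<in> vertices"
    using horizontal vertical by (auto simp: horizontal_iff vertical_iff mem_vertices_iff)
  then have "k < c" "c < j" "min a b < i" "i < max a b"
    using no_vertex assms(3-6) by (auto simp: le_less min_def max_def split: if_splits)
  then show False
    using row_length_inside_horizontal[OF horizontal] row_length_inside_vertical[OF vertical]
    by blast
qed

lemma horizontal_vertical_arcs_meet:
  assumes horizontal: "((i, j), (i, k)) \<in> horizontal_arcs"
    and vertical: "((a, c), (b, c)) \<in> vertical_arcs"
  shows "arc_segment (i, j) (i, k) \<inter> arc_segment (a, c) (b, c)
    \<subseteq> matrix_position ` ({(i, j), (i, k)} \<inter> {(a, c), (b, c)})"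
proof
  fix p assume p: "p \<in> arc_segment (i, j) (i, k) \<inter> arc_segment (a, c) (b, c)"
  obtain x y where xy: "p = (x, y)"
    by (cases p)
  have "k \<le> j"
    using horizontal by (simp add: horizontal_iff)
  then have "x = real c" "y = - real i" and "k \<le> c" "c \<le> j" "min a b \<le> i" "i \<le> max a b"
    using p by (auto simp: xy mem_arc_segment_horizontal mem_arc_segment_vertical)
  then have p_eq: "p = matrix_position (i, c)"
    by (simp add: xy matrix_position_def)
  have "(i, c) \<in> vertices"
    using \<open>k \<le> c\<close> \<open>c \<le> j\<close> \<open>min a b \<le> i\<close> \<open>i \<le> max a b\<close>
    by (rule crossing_is_vertex[OF horizontal vertical])
  then have "(i, c) \<in> {(i, j), (i, k)} \<inter> {(a, c), (b, c)}"
    using vertex_on_arc[of "(i, j)" "(i, k)" "(i, c)"] vertex_on_arc[of "(a, c)" "(b, c)" "(i, c)"]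
      horizontal vertical p p_eq by (simp add: parcs_kgr)
  then show "p \<in> matrix_position ` ({(i, j), (i, k)} \<inter> {(a, c), (b, c)})"
    unfolding p_eq by (rule imageI)
qed

lemma arcs_meet_in_common_ends:
  assumes uv: "(u, v) \<in> parcs kgr" and xy: "(x, y) \<in> parcs kgr" and "(u, v) \<noteq> (x, y)"
  shows "arc_segment u v \<inter> arc_segment x y \<subseteq> matrix_position ` ({u, v} \<inter> {x, y})"
proof -
  have "u \<noteq> x"
    using single_valuedD[OF single_valued_parcs_kgr uv] xy \<open>(u, v) \<noteq> (x, y)\<close> by blast
  from uv show ?thesis
  proof (cases rule: kgr_arc_cases)
    case uv: (horizontal i j k)
    from xy show ?thesis
    proof (cases rule: kgr_arc_cases)
      case xy: (horizontal i' j' k')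
      show ?thesis
        using horizontal_arcs_disjoint[OF uv(3) xy(3)] uv xy \<open>u \<noteq> x\<close> by simp
    next
      case xy: (vertical a b c)
      show ?thesis
        using horizontal_vertical_arcs_meet[OF uv(3) xy(3)] uv xy by simp
    qed
  next
    case uv: (vertical a b c)
    from xy show ?thesis
    proof (cases rule: kgr_arc_cases)
      case xy: (horizontal i j k)
      show ?thesis
        using horizontal_vertical_arcs_meet[OF xy(3) uv(3)] uv xy by (simp add: Int_commute)
    next
      case xy: (vertical a' b' c')
      show ?thesis
        using vertical_arcs_meet[OF uv(3) xy(3)] uv xy \<open>u \<noteq> x\<close> by simp
    qed
  qed
qed

lemma straight_line_plane_kgr: "straight_line_plane matrix_position kgr"
  unfolding straight_line_plane_def
proof (intro conjI ballI case_prodI2 impI)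
  show "inj_on matrix_position (pverts kgr)"
    by (auto simp: inj_on_def matrix_position_def)
  show "w \<in> {u, v}"
    if "a \<in> parcs kgr" "a = (u, v)" "w \<in> pverts kgr" "matrix_position w \<in> arc_segment u v"
    for a u v w
    using that vertex_on_arc pverts_kgr by blast
  show "arc_segment u v \<inter> arc_segment x y \<subseteq> matrix_position ` ({u, v} \<inter> {x, y})"
    if "a \<in> parcs kgr" "a = (u, v)" "b \<in> parcs kgr" "b = (x, y)" "(u, v) \<noteq> (x, y)"
    for a u v b x y
    using that arcs_meet_in_common_ends by blast
qed

end

section \<open>Decompositions from balanced sets of vertices\<close>

context kostka_pair
begin

definition vertical_closed :: "(nat \<times> nat) set \<Rightarrow> bool" where
  "vertical_closed V \<longleftrightarrow> V \<subseteq> vertices \<and> (\<forall>(u, v)\<in>vertical_arcs. u \<in> V \<longleftrightarrow> v \<in> V)"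

lemma vertical_closed_complement:
  assumes "vertical_closed V"
  shows "vertical_closed (vertices - V)"
  using assms unfolding vertical_closed_def kgr_vertical_def by blast

lemma vertical_closed_column:
  assumes V: "vertical_closed V" and x: "(x, c) \<in> V" and z: "(z, c) \<in> vertices"
  shows "(z, c) \<in> V"
proof -
  have x_vertex: "(x, c) \<in> vertices"
    using V x by (auto simp: vertical_closed_def)
  have "c < l 0"
    using z by (simp add: mem_vertices_iff)
  show ?thesis
  proof (cases "\<exists>y. star y c = -1")
    case True
    then obtain y where neg1: "star y c = -1"
      by blast
    have "(w, c) \<in> V \<longleftrightarrow> (y, c) \<in> V" if "(w, c) \<in> vertices" for w
    proof (cases "star w c = -1")
      case True
      then show ?thesis
        using neg1_unique_in_column[OF \<open>c < l 0\<close> neg1] by simp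
    next
      case False
      then have "((w, c), (y, c)) \<in> vertical_arcs"
        using that neg1 star_cases[OF \<open>c < l 0\<close>, of w] by (auto simp: mem_vertices_iff vertical_iff)
      with V show ?thesis
        unfolding vertical_closed_def by blast
    qed
    then show ?thesis
      using x x_vertex z by blast
  next
    case False
    then have "star x c = 1" "star z c = 1"
      using x_vertex z star_cases[OF \<open>c < l 0\<close>] by (auto simp: mem_vertices_iff)
    then have "x = z"
      using column_without_neg1[OF \<open>c < l 0\<close>] False by blast
    with x show ?thesis
      by simp
  qed
qed

definition leaving :: "(nat \<times> nat) set \<Rightarrow> nat \<Rightarrow> nat set" where
  "leaving V i = {c. \<exists>d. ((i, c), (i, d)) \<in> horizontal_arcs \<and> (i, c) \<in> V \<and> (i, d) \<notin> V}"

definition unpaired :: "(nat \<times> nat) set \<Rightarrow> nat \<Rightarrow> nat set" where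
  "unpaired V i = {d. (i, d) \<in> V \<and> star i d = 1 \<and>
     (\<forall>c. ((i, c), (i, d)) \<in> horizontal_arcs \<longrightarrow> (i, c) \<notin> V)}"

definition balanced :: "(nat \<times> nat) set \<Rightarrow> bool" where
  "balanced V \<longleftrightarrow> (\<forall>i. card (leaving V i) \<le> card (unpaired V i))"

lemma vertical_closed_subset: "vertical_closed V \<Longrightarrow> V \<subseteq> vertices"
  by (simp add: vertical_closed_def)

lemma columns_subset: "V \<subseteq> vertices \<Longrightarrow> snd ` V \<subseteq> {..<l 0}"
  by (auto simp: mem_vertices_iff)

lemma finite_columns: "V \<subseteq> vertices \<Longrightarrow> finite (snd ` V)"
  by (rule finite_subset[OF columns_subset]) simp_all

lemma finite_row: "V \<subseteq> vertices \<Longrightarrow> finite {c. (i, c) \<in> V}"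
  by (rule finite_subset[of _ "{..<l 0}"]) (auto simp: mem_vertices_iff)

lemma card_leaving_le_unpaired:
  assumes "V \<subseteq> vertices" and "d \<in> unpaired V i"
    and unique: "\<And>c c'. c \<in> leaving V i \<Longrightarrow> c' \<in> leaving V i \<Longrightarrow> c = c'"
  shows "card (leaving V i) \<le> card (unpaired V i)"
proof -
  have fin: "finite (leaving V i)" "finite (unpaired V i)"
    using finite_row[OF assms(1), of i]
    by (rule finite_subset[rotated]; auto simp: leaving_def unpaired_def)+
  have "card (leaving V i) \<le> Suc 0"
    using unique fin(1) by (simp add: card_le_Suc0_iff_eq)
  also have "\<dots> \<le> card (unpaired V i)"
    using assms(2) fin(2) by (metis Suc_leI card_gt_0_iff empty_iff)
  finally show ?thesis .
qed

lemma card_neg1_le_card_1: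
  assumes V: "V \<subseteq> vertices" and balanced: "balanced V"
  shows "card {c. (i, c) \<in> V \<and> star i c = -1} \<le> card {c. (i, c) \<in> V \<and> star i c = 1}"
proof -
  define paired where
    "paired = {(c, d). ((i, c), (i, d)) \<in> horizontal_arcs \<and> (i, c) \<in> V \<and> (i, d) \<in> V}"
  have finite_in_row: "finite B" if "B \<subseteq> {c. (i, c) \<in> V}" for B
    using that finite_row[OF V] finite_subset by blast
  have "paired \<subseteq> {c. (i, c) \<in> V} \<times> {c. (i, c) \<in> V}"
    by (auto simp: paired_def)
  then have "finite paired"
    using finite_row[OF V] finite_subset by blast
  have "{c. (i, c) \<in> V \<and> star i c = -1} \<subseteq> fst ` paired \<union> leaving V i"
  proof
    fix c assume "c \<in> {c. (i, c) \<in> V \<and> star i c = -1}"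
    then have neg1: "(i, c) \<in> V" "star i c = -1"
      by auto
    then have "c < l 0"
      using V by (auto simp: mem_vertices_iff)
    then obtain d where "((i, c), (i, d)) \<in> horizontal_arcs"
      using horizontal_exists neg1(2) by blast
    with neg1 show "c \<in> fst ` paired \<union> leaving V i"
      by (force simp: paired_def leaving_def)
  qed
  moreover have "finite (fst ` paired \<union> leaving V i)"
    by (rule finite_in_row) (auto simp: paired_def leaving_def)
  ultimately have "card {c. (i, c) \<in> V \<and> star i c = -1} \<le> card (fst ` paired \<union> leaving V i)"
    by (rule card_mono[rotated])
  also have "\<dots> \<le> card (fst ` paired) + card (leaving V i)"
    by (rule card_Un_le)
  also have "\<dots> \<le> card paired + card (unpaired V i)"
    using balanced card_image_le[OF \<open>finite paired\<close>] by (intro add_mono) (auto simp: balanced_def)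
  also have "card paired = card (snd ` paired)"
    using horizontal_unique_source
    by (intro card_image[symmetric] inj_onI) (force simp: paired_def)
  also have "card (snd ` paired) + card (unpaired V i) = card (snd ` paired \<union> unpaired V i)"
    by (rule card_Un_disjoint[symmetric]) (auto intro!: finite_in_row simp: paired_def unpaired_def)
  also have "\<dots> \<le> card {c. (i, c) \<in> V \<and> star i c = 1}"
    by (rule card_mono) (auto intro!: finite_in_row simp: paired_def unpaired_def horizontal_iff)
  finally show ?thesis .
qed

lemma sum_star_nonneg:
  assumes V: "V \<subseteq> vertices" and balanced: "balanced V"
  shows "0 \<le> (\<Sum>c | (i, c) \<in> V. star i c)"
proof -
  let ?R = "{c. (i, c) \<in> V}"
  have "(\<Sum>c\<in>?R. star i c) = (\<Sum>c\<in>?R. of_bool (star i c = 1) - of_bool (star i c = -1))"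
  proof (rule sum.cong)
    fix c assume "c \<in> ?R"
    then show "star i c = of_bool (star i c = 1) - of_bool (star i c = -1)"
      using V star_cases[of c i] by (auto simp: mem_vertices_iff)
  qed simp
  also have "\<dots> = int (card {c. (i, c) \<in> V \<and> star i c = 1}) -
      int (card {c. (i, c) \<in> V \<and> star i c = -1})"
    using finite_row[OF V] by (simp add: sum_subtractf Collect_conj_eq)
  finally show ?thesis
    using card_neg1_le_card_1[OF assms, of i] by simp
qed

lemma sum_star_columns:
  assumes V: "vertical_closed V"
  shows "(\<Sum>c\<in>snd ` V. star i c) = (\<Sum>c | (i, c) \<in> V. star i c)"
proof (rule sum.mono_neutral_right)
  have subset: "V \<subseteq> vertices"
    using V by (rule vertical_closed_subset)
  then show "finite (snd ` V)"
    by (rule finite_columns)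
  show "{c. (i, c) \<in> V} \<subseteq> snd ` V"
    by force
  show "\<forall>c\<in>snd ` V - {c. (i, c) \<in> V}. star i c = 0"
    using columns_subset[OF subset] vertical_closed_column[OF V]
    by (fastforce simp: mem_vertices_iff)
qed

definition column_part :: "(nat \<times> nat) set \<Rightarrow> (nat \<Rightarrow> nat) \<times> (nat \<Rightarrow> nat)" where
  "column_part V = (shape (snd ` V) chosen, row_sums (snd ` V) chosen)"

lemma column_part_in_Kostka:
  assumes V: "vertical_closed V" and balanced: "balanced V"
  shows "column_part V \<in> Kostka r"
  unfolding column_part_def
proof (rule shape_row_sums_in_Kostka)
  let ?J = "snd ` V"
  have subset: "V \<subseteq> vertices"
    using V by (rule vertical_closed_subset)
  then show finite: "finite ?J"
    by (rule finite_columns)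
  have row_sum: "int (row_sums ?J chosen i) = (\<Sum>c\<in>?J. of_bool (i \<in> chosen c))" for i
    using finite by (simp add: row_sums_def Collect_conj_eq)
  have "row_sums ?J chosen (Suc i) \<le> row_sums ?J chosen i" for i
  proof -
    have "int (row_sums ?J chosen i) - int (row_sums ?J chosen (Suc i)) = (\<Sum>c\<in>?J. star i c)"
      unfolding row_sum sum_subtractf[symmetric] using columns_subset[OF subset]
      by (intro sum.cong) (auto simp: star_eq)
    also have "\<dots> = (\<Sum>c | (i, c) \<in> V. star i c)"
      by (rule sum_star_columns[OF V])
    also have "\<dots> \<ge> 0"
      by (rule sum_star_nonneg[OF subset balanced])
    finally show ?thesis
      by simp
  qed
  then show "antimono (row_sums ?J chosen)"
    by (simp add: decseq_Suc_iff)
qed (rule chosen_subset)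

lemma column_part_nonzero:
  assumes "V \<subseteq> vertices" "V \<noteq> {}"
  shows "column_part V \<noteq> 0"
proof -
  have "{c \<in> snd ` V. 0 < card (chosen c)} = snd ` V"
    using columns_subset[OF assms(1)] less_conjugate_iff[OF partition_l, of 0]
    by (auto simp: card_chosen)
  then have "shape (snd ` V) chosen 0 \<noteq> 0"
    using assms(2) finite_columns[OF assms(1)] by (simp add: shape_def)
  then show ?thesis
    by (auto simp: column_part_def zero_prod_def)
qed

lemma columns_of_vertices: "snd ` vertices = {..<l 0}"
proof
  show "snd ` vertices \<subseteq> {..<l 0}"
    by (rule columns_subset) simp
  show "{..<l 0} \<subseteq> snd ` vertices"
    using column_has_vertex by (metis imageI lessThan_iff snd_conv subsetI)
qed

lemma column_part_add_complement:
  assumes V: "vertical_closed V"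
  shows "(l, m) = column_part V + column_part (vertices - V)"
proof -
  let ?J = "snd ` V" and ?K = "snd ` (vertices - V)"
  have subset: "V \<subseteq> vertices"
    using V by (rule vertical_closed_subset)
  have "finite ?J" "finite ?K"
    using subset by (auto intro: finite_columns)
  moreover have "?J \<inter> ?K = {}"
    using vertical_closed_column[OF V] by auto
  moreover have "?J \<union> ?K = {..<l 0}"
    using subset columns_of_vertices by blast
  ultimately have "shape {..<l 0} chosen = shape ?J chosen + shape ?K chosen"
    and "row_sums {..<l 0} chosen = row_sums ?J chosen + row_sums ?K chosen"
    by (metis shape_Un, metis row_sums_Un)
  moreover have "row_sums {..<l 0} chosen = m"
    using row_sums_chosen[of "l 0"] by (simp add: row_length_initial fun_eq_iff)
  ultimately show ?thesis
    by (simp only: column_part_def plus_prod_def fst_conv snd_conv shape_chosen)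
qed

lemma balanced_split_not_in_hilbert_basis:
  assumes V: "vertical_closed V" "V \<noteq> {}" "V \<noteq> vertices"
    and balanced: "balanced V" "balanced (vertices - V)"
  shows "(l, m) \<notin> hilbert_basis (Kostka r)"
proof -
  have "column_part V \<in> Kostka r" "column_part (vertices - V) \<in> Kostka r"
    using V(1) balanced by (auto intro: column_part_in_Kostka vertical_closed_complement)
  moreover have "column_part V \<noteq> 0" "column_part (vertices - V) \<noteq> 0"
    using V column_part_nonzero[of V] column_part_nonzero[of "vertices - V"]
      vertical_closed_subset[OF V(1)] by blast+
  ultimately show ?thesis
    using column_part_add_complement[OF V(1)] unfolding hilbert_basis_def by blast
qed

section \<open>Conservative subtrees\<close>

lemma component_not_in_hilbert_basis:
  assumes component: "connected_component_of H kgr" and nontrivial: "pverts H \<noteq> {}" "H \<noteq> kgr"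
  shows "(l, m) \<notin> hilbert_basis (Kostka r)"
proof (rule balanced_split_not_in_hilbert_basis)
  have arc: "u \<in> pverts H \<longleftrightarrow> v \<in> pverts H"
    if "(u, v) \<in> horizontal_arcs \<union> vertical_arcs" for u v
    using component_contains_arc(1,2)[OF component, of u v] that by (auto simp: parcs_kgr)
  have "pverts H \<subseteq> vertices"
    using component
    by (auto simp: connected_component_of_def pre_digraph.max_subgraph_def subgraph_def pverts_kgr)
  then show "vertical_closed (pverts H)"
    using arc unfolding vertical_closed_def by blast
  show "pverts H \<noteq> {}"
    by (rule nontrivial(1))
  show "pverts H \<noteq> vertices"
    using component_eq_of_spanning[OF component] nontrivial(2) by (auto simp: pverts_kgr)
  have "leaving (pverts H) i = {}" "leaving (vertices - pverts H) i = {}" for i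
    using arc unfolding leaving_def kgr_horizontal_def by blast+
  then show "balanced (pverts H)" "balanced (vertices - pverts H)"
    by (simp_all add: balanced_def)
qed

end

locale sink_subtree = kostka_pair +
  fixes H :: "(nat \<times> nat) pair_pre_digraph" and i j k :: nat
  assumes subgraph: "subgraph (with_proj H) (with_proj kgr)"
    and whole_columns: "((x, c), (y, c)) \<in> parcs H \<inter> vertical_arcs \<Longrightarrow>
      ((x', c), (y', c)) \<in> vertical_arcs \<Longrightarrow> ((x', c), (y', c)) \<in> parcs H"
    and sink: "graph_sinks H = {(i, j)}" "star i j = -1"
    and source: "(i, k) \<in> graph_sources H" "star i k = 1"
    and other_sources: "graph_sources H - {(i, k)} \<subseteq> graph_sources kgr"
begin

lemma verts_subset: "pverts H \<subseteq> vertices" and arcs_subset: "parcs H \<subseteq> parcs kgr"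
  and wf_digraph: "wf_digraph (with_proj H)"
  using subgraph by (auto simp: subgraph_def pverts_kgr)

lemma sink_in_verts: "(i, j) \<in> pverts H" and source_in_verts: "(i, k) \<in> pverts H"
  using sink(1) source(1) mem_graph_sinks_iff[of "(i, j)" H] mem_graph_sources_iff[of "(i, k)" H]
  by auto

lemma arc_out:
  assumes "u \<in> pverts H" "u \<noteq> (i, j)" "(u, v) \<in> parcs kgr"
  shows "(u, v) \<in> parcs H"
proof -
  obtain w where w: "(u, w) \<in> parcs H"
    using assms(1,2) sink(1) mem_graph_sinks_iff[of u H] by blast
  then have "w = v"
    using arcs_subset assms(3) single_valuedD[OF single_valued_parcs_kgr] by blast
  with w show ?thesis
    by simp
qed

lemma arc_in:
  assumes v: "v \<in> pverts H" "v \<noteq> (i, k)" and uv: "(u, v) \<in> parcs kgr"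
  shows "(u, v) \<in> parcs H"
proof -
  have "v \<notin> graph_sources kgr"
    using uv mem_graph_sources_iff[of v kgr] by blast
  then obtain u' where u': "(u', v) \<in> parcs H"
    using v other_sources mem_graph_sources_iff[of v H] by blast
  then have u'v: "(u', v) \<in> parcs kgr"
    using arcs_subset by blast
  from uv show ?thesis
  proof (cases rule: kgr_arc_cases)
    case uv_horizontal: (horizontal a c d)
    from u'v have "u' = u"
    proof (cases rule: kgr_arc_cases)
      case (horizontal a' c' d')
      then show ?thesis
        using uv_horizontal horizontal_unique_source by blast
    qed (use uv_horizontal in \<open>simp add: horizontal_iff vertical_iff\<close>)
    with u' show ?thesis
      by simp
  next
    case uv_vertical: (vertical a b c)
    from u'v show ?thesis
    proof (cases rule: kgr_arc_cases)
      case (vertical a' b' c')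
      then show ?thesis
        using uv_vertical u' whole_columns by blast
    qed (use uv_vertical in \<open>simp add: horizontal_iff vertical_iff\<close>)
  qed
qed

lemma target_of_sink:
  assumes "((i, j), w) \<in> parcs kgr"
  shows "w \<notin> pverts H"
proof
  assume "w \<in> pverts H"
  moreover have "wf ((parcs H)\<inverse>)"
    using wf_subset[OF wf_converse_parcs_kgr] arcs_subset by auto
  ultimately have "(w, (i, j)) \<in> (parcs H)\<^sup>*"
    by (intro unique_sink_reachable[OF wf_digraph _ sink(1)])
  then have "((i, j), (i, j)) \<in> (parcs kgr)\<^sup>+"
    using assms rtrancl_mono[OF arcs_subset] by (meson rtrancl_into_trancl2 subsetD)
  then show False
    using acyclic_parcs_kgr by (simp add: acyclic_def)
qed

lemma vertical_closed_verts: "vertical_closed (pverts H)"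
  unfolding vertical_closed_def
proof (intro conjI ballI case_prodI2)
  fix a u v assume "a \<in> vertical_arcs" "a = (u, v)"
  then have "(u, v) \<in> parcs kgr" "u \<noteq> (i, j)" "v \<noteq> (i, k)"
    using sink(2) source(2) by (auto simp: parcs_kgr kgr_vertical_def)
  then show "u \<in> pverts H \<longleftrightarrow> v \<in> pverts H"
    using arc_out arc_in wf_digraph_with_projD[OF wf_digraph] by blast
qed (rule verts_subset)

lemma horizontal_leaving:
  assumes "((x, c), (x, d)) \<in> horizontal_arcs" "(x, c) \<in> pverts H" "(x, d) \<notin> pverts H"
  shows "x = i \<and> c = j"
proof (rule ccontr)
  assume "\<not> (x = i \<and> c = j)"
  with assms have "((x, c), (x, d)) \<in> parcs H"
    by (intro arc_out) (auto simp: parcs_kgr)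
  with assms(3) show False
    using wf_digraph_with_projD(2)[OF wf_digraph] by blast
qed

lemma horizontal_entering:
  assumes "((x, c), (x, d)) \<in> horizontal_arcs" "(x, c) \<notin> pverts H" "(x, d) \<in> pverts H"
  shows "x = i \<and> d = k"
proof (rule ccontr)
  assume "\<not> (x = i \<and> d = k)"
  with assms have "((x, c), (x, d)) \<in> parcs H"
    by (intro arc_in) (auto simp: parcs_kgr)
  with assms(2) show False
    using wf_digraph_with_projD(1)[OF wf_digraph] by blast
qed

lemma sink_has_target_outside:
  obtains w where "((i, j), (i, w)) \<in> horizontal_arcs" "(i, w) \<in> vertices - pverts H"
proof -
  have "j < l 0"
    using sink_in_verts verts_subset by (auto simp: mem_vertices_iff)
  then obtain w where w: "((i, j), (i, w)) \<in> horizontal_arcs"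
    using horizontal_exists sink(2) by blast
  then have "(i, w) \<in> vertices" "(i, w) \<notin> pverts H"
    using target_of_sink[of "(i, w)"] by (auto simp: parcs_kgr kgr_horizontal_def)
  with w show thesis
    using that by blast
qed

text \<open>The source \<open>(i, k)\<close> makes up for the target that the sink loses, and vice versa outside.\<close>

lemma balanced_verts: "balanced (pverts H)"
  unfolding balanced_def
proof
  fix x
  show "card (leaving (pverts H) x) \<le> card (unpaired (pverts H) x)"
  proof (cases "x = i")
    case True
    have "(i, c) \<notin> pverts H" if "((i, c), (i, k)) \<in> horizontal_arcs" for c
    proof
      assume c: "(i, c) \<in> pverts H"
      have arc: "((i, c), (i, k)) \<in> parcs kgr"
        using that by (simp add: parcs_kgr)
      then have "(i, c) \<noteq> (i, j)"
        using target_of_sink source_in_verts by blast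
      then have "((i, c), (i, k)) \<in> parcs H"
        by (rule arc_out[OF c _ arc])
      then show False
        using source(1) mem_graph_sources_iff[of "(i, k)" H] by blast
    qed
    then have "k \<in> unpaired (pverts H) x"
      using source_in_verts source(2) True by (simp add: unpaired_def)
    with verts_subset show ?thesis
      by (rule card_leaving_le_unpaired) (use horizontal_leaving in \<open>unfold leaving_def, blast\<close>)
  next
    case False
    then have "leaving (pverts H) x = {}"
      using horizontal_leaving unfolding leaving_def by blast
    then show ?thesis
      by simp
  qed
qed

lemma balanced_complement: "balanced (vertices - pverts H)"
  (is "balanced ?W")
  unfolding balanced_def
proof
  fix x
  have entering: "x = i \<and> d = k"
    if "((x, c), (x, d)) \<in> horizontal_arcs" "(x, c) \<in> ?W" "(x, d) \<notin> ?W" for c d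
  proof -
    have "(x, d) \<in> vertices"
      using that(1) unfolding kgr_horizontal_def by blast
    with that show ?thesis
      using horizontal_entering by blast
  qed
  show "card (leaving ?W x) \<le> card (unpaired ?W x)"
  proof (cases "x = i")
    case True
    obtain w where w: "((i, j), (i, w)) \<in> horizontal_arcs" "(i, w) \<in> ?W"
      by (rule sink_has_target_outside)
    have "(i, c) \<notin> ?W" if "((i, c), (i, w)) \<in> horizontal_arcs" for c
      using horizontal_unique_source[OF that w(1)] sink_in_verts by simp
    moreover have "star i w = 1"
      using w(1) by (simp add: horizontal_iff)
    ultimately have "w \<in> unpaired ?W x"
      using w(2) True by (simp add: unpaired_def)
    moreover have "c = c'" if "c \<in> leaving ?W x" "c' \<in> leaving ?W x" for c c'
      using that entering horizontal_unique_source unfolding leaving_def by blast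
    ultimately show ?thesis
      by (intro card_leaving_le_unpaired) auto
  next
    case False
    then have "leaving ?W x = {}"
      using entering unfolding leaving_def by blast
    then show ?thesis
      by simp
  qed
qed

lemma not_in_hilbert_basis: "(l, m) \<notin> hilbert_basis (Kostka r)"
proof (rule balanced_split_not_in_hilbert_basis[OF vertical_closed_verts])
  show "pverts H \<noteq> {}"
    using sink_in_verts by blast
  show "pverts H \<noteq> vertices"
    using sink_has_target_outside by blast
qed (rule balanced_verts balanced_complement)+

end

lemma (in kostka_pair) conservative_subtree_not_in_hilbert_basis:
  assumes "conservative_subtree r l m H"
  shows "(l, m) \<notin> hilbert_basis (Kostka r)"
proof (cases "connected_component_of H kgr")
  case True
  then show ?thesis
    using component_not_in_hilbert_basis assms by (simp add: conservative_subtree_def)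
next
  case False
  then obtain i j k where "graph_sinks H = {(i, j)}" "star i j = -1"
    "(i, k) \<in> graph_sources H" "star i k = 1" "graph_sources H - {(i, k)} \<subseteq> graph_sources kgr"
    using assms by (auto simp: conservative_subtree_def)
  then interpret sink_subtree r l m H i j k
    using assms by unfold_locales (unfold conservative_subtree_def, blast+)
  show ?thesis
    by (rule not_in_hilbert_basis)
qed

theorem theorem2p8:
  fixes r :: nat and l m :: "nat \<Rightarrow> nat"
  assumes "r \<ge> 1" and "(l, m) \<in> Kostka r"
  shows "undirected_forest (kgr_graph r l m) \<and>
    straight_line_plane matrix_position (kgr_graph r l m) \<and>
    (\<forall>H. conservative_subtree r l m H \<longrightarrow> undirected_tree H) \<and>
    ((\<exists>H. conservative_subtree r l m H) \<longrightarrow> (l, m) \<notin> hilbert_basis (Kostka r))"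
proof -
  interpret kostka_pair r l m
    using assms(2) by unfold_locales
  have "undirected_tree H" if "conservative_subtree r l m H" for H
    using that undirected_forest_subgraph[of H]
    by (auto simp: conservative_subtree_def undirected_tree_def subgraph_def)
  then show ?thesis
    using undirected_forest_subgraph[of kgr] straight_line_plane_kgr
      conservative_subtree_not_in_hilbert_basis by blast
qed

end
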